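(* Let $L=L_1\sqcup L_2$ be a separated union of two $(k-1)$-dimensional submanifolds $L_1,L_2$ of $S^{n-1}$, where $S^{n-1}$ is viewed as the sphere at infinity of the hyperbolic space $\mathbb{H}^n$. Then $L$ can be rearranged in its isotopy class such that there is no connected minimal $k$-dimensional submanifold $\Sigma$ of $\mathbb{H}^n$ whose ideal boundary is $L$.
   Context: $\mathbb{H}^n$ is compactified as the closed unit ball (Poincaré model), with sphere at infinity $S^{n-1}$; the ideal boundary of a submanifold is its boundary at infinity in $S^{n-1}$. Separated union means that $L_1$ and $L_2$ lie in two disjoint balls of $S^{n-1}$, so that by an isotopy of $S^{n-1}$ they can be moved into small balls around the North and South poles respectively. Minimal means vanishing mean curvature.
   Formalization: The formal statement assumes k ≥ 2 and that L_1 and L_2 are nonempty; for k = 1 two single points are always joined by a geodesic, and with one piece empty a circle in S^2 always bounds a minimal disc. Σ is taken properly embedded. *)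

theory Defs
  imports "HOL-Analysis.Analysis"
begin

section \<open>Smooth maps, diffeomorphisms, submanifolds\<close>

primrec Ck_on :: "nat \<Rightarrow> ('a::euclidean_space \<Rightarrow> 'b::euclidean_space) \<Rightarrow> 'a set \<Rightarrow> bool" where
  "Ck_on 0 f U \<longleftrightarrow> continuous_on U f"
| "Ck_on (Suc m) f U \<longleftrightarrow>
     (\<forall>x\<in>U. f differentiable (at x)) \<and> (\<forall>v. Ck_on m (\<lambda>x. frechet_derivative f (at x) v) U)"

text \<open>Meant for open \<open>U\<close>; for other sets use \<open>smooth_map_on\<close>, which asks for local smooth extensions.\<close>

definition smooth_on :: "'a::euclidean_space set \<Rightarrow> ('a \<Rightarrow> 'b::euclidean_space) \<Rightarrow> bool" where
  "smooth_on U f \<longleftrightarrow> (\<forall>m. Ck_on m f U)"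

definition smooth_map_on :: "'a::euclidean_space set \<Rightarrow> ('a \<Rightarrow> 'b::euclidean_space) \<Rightarrow> bool" where
  "smooth_map_on A f \<longleftrightarrow>
     (\<forall>x\<in>A. \<exists>U F. open U \<and> x \<in> U \<and> smooth_on U F \<and> (\<forall>y\<in>A \<inter> U. F y = f y))"

definition diffeomorphism_betw ::
    "'a::euclidean_space set \<Rightarrow> 'b::euclidean_space set \<Rightarrow> ('a \<Rightarrow> 'b) \<Rightarrow> bool" where
  "diffeomorphism_betw A B f \<longleftrightarrow>
     bij_betw f A B \<and> smooth_map_on A f \<and> smooth_map_on B (inv_into A f)"

text \<open>Embedded \<open>m\<close>-dimensional submanifolds without boundary, via slice charts. The set need not be
  closed. A subset of the unit sphere is a submanifold of the sphere iff it is one of the ambient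
  Euclidean space, and likewise for subsets of the open unit ball.\<close>

definition smooth_submanifold :: "nat \<Rightarrow> 'a::euclidean_space set \<Rightarrow> bool" where
  "smooth_submanifold m S \<longleftrightarrow>
     (\<forall>p\<in>S. \<exists>U V \<phi> (W::'a set). open U \<and> p \<in> U \<and> open V \<and> diffeomorphism_betw U V \<phi> \<and>
        subspace W \<and> dim W = m \<and> \<phi> ` (S \<inter> U) = W \<inter> V)"

definition tangent_space :: "'a::euclidean_space set \<Rightarrow> 'a \<Rightarrow> 'a set" where
  "tangent_space S p =
     {v. \<exists>\<gamma> \<epsilon>. \<epsilon> > 0 \<and> smooth_on {-\<epsilon><..<\<epsilon>} \<gamma> \<and> \<gamma> 0 = p \<and> (\<forall>t\<in>{-\<epsilon><..<\<epsilon>}. \<gamma> t \<in> S) \<and>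
           (\<gamma> has_vector_derivative v) (at (0::real))}"

section \<open>Mean curvature with respect to a Riemannian metric\<close>

text \<open>A Riemannian metric on an open subset of the Euclidean space \<open>'a\<close> is a function \<open>g\<close> giving, at
  each point \<open>x\<close>, an inner product \<open>g x\<close> on \<open>'a\<close>. The Christoffel map of its Levi-Civita connection is
  characterised by the Koszul formula for constant vector fields, whose brackets vanish.\<close>

definition christoffel :: "('a::euclidean_space \<Rightarrow> 'a \<Rightarrow> 'a \<Rightarrow> real) \<Rightarrow> 'a \<Rightarrow> 'a \<Rightarrow> 'a \<Rightarrow> 'a" where
  "christoffel g p u v = (THE w. \<forall>z. 2 * g p w z =
       frechet_derivative (\<lambda>x. g x v z) (at p) u
     + frechet_derivative (\<lambda>x. g x u z) (at p) v
     - frechet_derivative (\<lambda>x. g x u v) (at p) z)"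

definition covariant_derivative ::
    "('a::euclidean_space \<Rightarrow> 'a \<Rightarrow> 'a \<Rightarrow> real) \<Rightarrow> ('a \<Rightarrow> 'a) \<Rightarrow> 'a \<Rightarrow> 'a \<Rightarrow> 'a" where
  "covariant_derivative g X p u = frechet_derivative X (at p) u + christoffel g p u (X p)"

definition normal_component ::
    "('a::euclidean_space \<Rightarrow> 'a \<Rightarrow> 'a \<Rightarrow> real) \<Rightarrow> 'a set \<Rightarrow> 'a \<Rightarrow> 'a \<Rightarrow> 'a" where
  "normal_component g S p w =
     (THE z. w - z \<in> tangent_space S p \<and> (\<forall>t\<in>tangent_space S p. g p z t = 0))"

text \<open>The normal part of the derivative of \<open>X\<close> in direction \<open>u\<close>, where \<open>X\<close> is any local smooth vector
  field that is tangent to \<open>S\<close> along \<open>S\<close> and takes the value \<open>v\<close> at \<open>p\<close>; for tangent \<open>u\<close>, \<open>v\<close> the result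
  does not depend on \<open>X\<close>.\<close>

definition second_fundamental_form ::
    "('a::euclidean_space \<Rightarrow> 'a \<Rightarrow> 'a \<Rightarrow> real) \<Rightarrow> 'a set \<Rightarrow> 'a \<Rightarrow> 'a \<Rightarrow> 'a \<Rightarrow> 'a" where
  "second_fundamental_form g S p u v =
     (THE w. \<exists>U X. open U \<and> p \<in> U \<and> smooth_on U X \<and> (\<forall>q\<in>S \<inter> U. X q \<in> tangent_space S q) \<and>
        X p = v \<and> w = normal_component g S p (covariant_derivative g X p u))"

definition orthonormal_basis ::
    "('a::euclidean_space \<Rightarrow> 'a \<Rightarrow> 'a \<Rightarrow> real) \<Rightarrow> 'a \<Rightarrow> 'a set \<Rightarrow> 'a set \<Rightarrow> bool" where
  "orthonormal_basis g p T B \<longleftrightarrow>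
     independent B \<and> span B = T \<and> (\<forall>b\<in>B. \<forall>c\<in>B. g p b c = (if b = c then 1 else 0))"

text \<open>The normalised trace of the second fundamental form, which is independent of the orthonormal
  basis.\<close>

definition mean_curvature :: "('a::euclidean_space \<Rightarrow> 'a \<Rightarrow> 'a \<Rightarrow> real) \<Rightarrow> 'a set \<Rightarrow> 'a \<Rightarrow> 'a" where
  "mean_curvature g S p =
     (1 / real (dim (tangent_space S p))) *\<^sub>R
     (\<Sum>e\<in>(SOME B. orthonormal_basis g p (tangent_space S p) B). second_fundamental_form g S p e e)"

definition minimal :: "('a::euclidean_space \<Rightarrow> 'a \<Rightarrow> 'a \<Rightarrow> real) \<Rightarrow> 'a set \<Rightarrow> bool" where
  "minimal g S \<longleftrightarrow> (\<forall>p\<in>S. mean_curvature g S p = 0)"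

section \<open>Hyperbolic space and its sphere at infinity\<close>

text \<open>Poincare model: hyperbolic \<open>n\<close>-space, \<open>n = DIM('a)\<close>, is \<open>ball 0 1\<close> with the metric below, and its
  sphere at infinity is \<open>sphere 0 1\<close>.\<close>

definition hyperbolic_metric :: "'a::euclidean_space \<Rightarrow> 'a \<Rightarrow> 'a \<Rightarrow> real" where
  "hyperbolic_metric x u v = (2 / (1 - (norm x)\<^sup>2))\<^sup>2 * (u \<bullet> v)"

text \<open>Submanifolds of hyperbolic space have no boundary at finite distance: they are closed subsets
  of the open ball (properly embedded), so that they bound only at infinity.\<close>

definition hyperbolic_submanifold :: "nat \<Rightarrow> 'a::euclidean_space set \<Rightarrow> bool" where
  "hyperbolic_submanifold k M \<longleftrightarrow>
     smooth_submanifold k M \<and> closedin (top_of_set (ball 0 1)) M"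

definition ideal_boundary :: "'a::euclidean_space set \<Rightarrow> 'a set" where
  "ideal_boundary M = closure M \<inter> sphere 0 1"

text \<open>Open balls in the sphere are taken in the sense of differential topology; round open caps
  are a special case.\<close>

definition sphere_ball :: "'a::euclidean_space set \<Rightarrow> bool" where
  "sphere_ball B \<longleftrightarrow> openin (top_of_set (sphere 0 1)) B \<and>
     (\<exists>(W::'a set) f. subspace W \<and> dim W + 1 = DIM('a) \<and> diffeomorphism_betw (W \<inter> ball 0 1) B f)"

definition separated :: "'a::euclidean_space set \<Rightarrow> 'a set \<Rightarrow> bool" where
  "separated L1 L2 \<longleftrightarrow>
     (\<exists>B1 B2. sphere_ball B1 \<and> sphere_ball B2 \<and> B1 \<inter> B2 = {} \<and> L1 \<subseteq> B1 \<and> L2 \<subseteq> B2)"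

text \<open>Ambient isotopies of the sphere, smooth jointly in time and space.\<close>

definition sphere_isotopy :: "(real \<times> 'a::euclidean_space \<Rightarrow> 'a) \<Rightarrow> bool" where
  "sphere_isotopy h \<longleftrightarrow>
     smooth_map_on ({0..1} \<times> sphere 0 1) h \<and>
     (\<forall>t\<in>{0..1}. diffeomorphism_betw (sphere 0 1) (sphere 0 1) (\<lambda>x. h (t, x))) \<and>
     (\<forall>x\<in>sphere 0 1. h (0, x) = x)"

definition isotopic :: "'a::euclidean_space set \<Rightarrow> 'a set \<Rightarrow> bool" where
  "isotopic L L' \<longleftrightarrow> (\<exists>h. sphere_isotopy h \<and> (\<lambda>x. h (1, x)) ` L = L')"

end

theory Submission
  imports Defs
begin

text \<open>If \<open>L1 \<union> L2\<close> is not closed, it is not an ideal boundary and needs no rearranging. Otherwise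
  \<open>L1\<close> is compact, and an isotopy supported in the ball around it shrinks it towards one point \<open>u\<close>,
  while \<open>L2\<close> stays fixed. Seen from a point of the geodesic from \<open>-u\<close> to \<open>u\<close> that is close to \<open>u\<close>, the
  two pieces then lie in small caps around the two ends of this geodesic.

  On the hyperboloid let \<open>X0\<close>, \<open>Z\<close> be the time coordinate and the coordinate along the geodesic,
  centred at that point, and let \<open>1 \<le> c < 2\<close>. The function \<open>X0 ^ 2 - c * Z ^ 2\<close> tends to \<open>- \<infinity>\<close> at the caps,
  so on a minimal \<open>M\<close> that meets the hyperplane \<open>Z = 0\<close>, where it is at least \<open>1\<close>, it attains a maximum. At
  a critical point with a positive value the trace of its Hessian over the tangent space of \<open>M\<close> is
  positive as soon as \<open>c < dim M\<close>, which minimality forbids at a maximum. Hence \<open>M\<close> misses the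
  hyperplane and, being connected, cannot reach both caps.\<close>

section \<open>Calculus of smooth maps\<close>

text \<open>The bound \<open>2 \<le> k\<close> is forced: for \<open>k = 1\<close> a geodesic joins
  any two ideal points. It enters through the constant \<open>c\<close>. As
  \<open>X0 ^ 2 - Z ^ 2\<close> is at least \<open>1\<close> on the hyperboloid, only
  \<open>c > 1\<close> makes the barrier tend to minus infinity at the caps, while the trace
  estimate asks for \<open>c < k\<close>; hence \<open>c = 3/2\<close>. On the hyperboloid a linear
  coordinate has Hessian equal to itself times the metric. So at a critical point with value
  \<open>D \<ge> 1\<close> the Hessian of the barrier is \<open>2 * D\<close> times the metric, up
  to squares of differentials. Restricted to the tangent space, these squares combine into a form of
  rank one, of trace at most \<open>2 * c * D\<close>, against \<open>2 * k * D\<close> from the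
  metric term. The change of viewpoint is made by boosting the two coordinate functions while
  \<open>M\<close> stays where it is; all computations take place in the ball, with Euclidean
  derivatives and an explicit conformal correction.\<close>

lemma Ck_on_subset: "Ck_on m f U \<Longrightarrow> V \<subseteq> U \<Longrightarrow> Ck_on m f V"
  by (induction m arbitrary: f) (auto intro: continuous_on_subset)

lemma Ck_on_cong:
  assumes "open U" "\<And>x. x \<in> U \<Longrightarrow> f x = g x" "Ck_on m f U"
  shows "Ck_on m g U"
  using assms(2,3)
proof (induction m arbitrary: f g)
  case 0
  then show ?case using continuous_on_cong by (metis Ck_on.simps(1))
next
  case (Suc m)
  have der: "(g has_derivative frechet_derivative f (at x)) (at x)" if "x \<in> U" for x
  proof -
    have "(f has_derivative frechet_derivative f (at x)) (at x)"
      using Suc.prems(2) that frechet_derivative_works by auto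
    then show ?thesis
      using has_derivative_transform_within_open[OF _ assms(1) that] Suc.prems(1) by blast
  qed
  then have "frechet_derivative f (at x) = frechet_derivative g (at x)" if "x \<in> U" for x
    using frechet_derivative_at that by blast
  then have "Ck_on m (\<lambda>x. frechet_derivative g (at x) v) U" for v
    using Suc.IH[of "\<lambda>x. frechet_derivative f (at x) v"] Suc.prems(2) by simp
  with der show ?case by (auto simp: differentiable_def)
qed

text \<open>Lets the inductions below supply an explicit derivative formula in place of
  \<open>frechet_derivative\<close>.\<close>

lemma Ck_on_SucI:
  assumes "\<And>x. x \<in> U \<Longrightarrow> (f has_derivative f' x) (at x)"
    and "\<And>v. Ck_on m (\<lambda>x. f' x v) U" and "open U"
  shows "Ck_on (Suc m) f U"
proof -
  have "f' x = frechet_derivative f (at x)" if "x \<in> U" for x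
    using frechet_derivative_at[OF assms(1)[OF that]] by simp
  then have "Ck_on m (\<lambda>x. frechet_derivative f (at x) v) U" for v
    using Ck_on_cong[OF assms(3) _ assms(2)[of v]] by simp
  then show ?thesis
    using assms(1) by (auto simp: differentiable_def)
qed

lemma Ck_on_has_derivative:
  "Ck_on (Suc m) f U \<Longrightarrow> x \<in> U \<Longrightarrow> (f has_derivative frechet_derivative f (at x)) (at x)"
  using frechet_derivative_works by auto

lemma Ck_on_SucD: "Ck_on (Suc m) f U \<Longrightarrow> Ck_on m f U"
proof (induction m arbitrary: f)
  case 0
  then show ?case
    by (auto intro!: continuous_at_imp_continuous_on differentiable_imp_continuous_within)
qed auto

lemma Ck_on_local:
  assumes "\<And>x. x \<in> U \<Longrightarrow> \<exists>V. open V \<and> x \<in> V \<and> Ck_on m f V"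
  shows "Ck_on m f U"
  using assms
proof (induction m arbitrary: f)
  case 0
  show ?case
    unfolding Ck_on.simps
  proof (rule continuous_at_imp_continuous_on, rule ballI)
    fix x assume "x \<in> U"
    from 0[OF this] obtain V where "open V" "x \<in> V" "continuous_on V f" by auto
    then show "isCont f x" using continuous_on_eq_continuous_at by blast
  qed
next
  case (Suc m)
  then show ?case
    by (simp, meson)
qed

lemma Ck_on_const: "Ck_on m (\<lambda>x. c) U"
  by (induction m arbitrary: c) auto

lemma Ck_on_bounded_linear:
  assumes "bounded_linear f" "open U"
  shows "Ck_on m f U"
proof (cases m)
  case 0
  then show ?thesis using assms(1) by (simp add: linear_continuous_on)
next
  case (Suc k)
  show ?thesis
    unfolding Suc
    by (rule Ck_on_SucI[where f'="\<lambda>x. f"])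
      (use assms in \<open>auto simp: bounded_linear_imp_has_derivative Ck_on_const\<close>)
qed

lemma Ck_on_compose_linear:
  assumes "bounded_linear l" "open U" "Ck_on m f U"
  shows "Ck_on m (\<lambda>x. l (f x)) U"
  using assms(3)
proof (induction m arbitrary: f)
  case 0
  then show ?case by (simp add: assms(1) bounded_linear.continuous_on)
next
  case (Suc m)
  show ?case
    by (rule Ck_on_SucI[where f'="\<lambda>x v. l (frechet_derivative f (at x) v)"])
      (use Suc assms in \<open>auto intro: bounded_linear.has_derivative[OF assms(1)] 
         simp flip: frechet_derivative_works\<close>)
qed

lemma Ck_on_add:
  assumes "open U" "Ck_on m f U" "Ck_on m g U"
  shows "Ck_on m (\<lambda>x. f x + g x) U"
  using assms(2,3)
proof (induction m arbitrary: f g)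
  case 0
  then show ?case by (simp add: continuous_on_add)
next
  case (Suc m)
  show ?case
    by (rule Ck_on_SucI[where f'="\<lambda>x v. frechet_derivative f (at x) v + frechet_derivative g (at x) v"])
      (use Suc assms in \<open>auto intro!: has_derivative_add simp flip: frechet_derivative_works\<close>)
qed

lemma Ck_on_sum:
  assumes "open U" "\<And>i. i \<in> I \<Longrightarrow> Ck_on m (f i) U"
  shows "Ck_on m (\<lambda>x. \<Sum>i\<in>I. f i x) U"
  using assms(2)
  by (induction I rule: infinite_finite_induct) (auto simp: Ck_on_const Ck_on_add assms(1))

lemma Ck_on_bilinear:
  assumes b: "bounded_bilinear b" and "open U" "Ck_on m f U" "Ck_on m g U"
  shows "Ck_on m (\<lambda>x. b (f x) (g x)) U"
  using assms(3,4)
proof (induction m arbitrary: f g)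
  case 0
  then show ?case by (simp add: bounded_bilinear.continuous_on[OF b])
next
  case (Suc m)
  show ?case
  proof (rule Ck_on_SucI[where
        f'="\<lambda>x v. b (f x) (frechet_derivative g (at x) v) + b (frechet_derivative f (at x) v) (g x)"])
    show "Ck_on m (\<lambda>x. b (f x) (frechet_derivative g (at x) v) + b (frechet_derivative f (at x) v) (g x)) U" for v
      using Suc.prems Ck_on_SucD[OF Suc.prems(1)] Ck_on_SucD[OF Suc.prems(2)]
      by (intro Ck_on_add Suc.IH assms(2)) auto
  qed (use Suc assms in \<open>auto intro!: bounded_bilinear.FDERIV[OF b] simp flip: frechet_derivative_works\<close>)
qed

text \<open>\<open>Ck_on\<close> speaks of derivatives in a fixed direction only. Where the
  direction varies with the point, as in the chain rule, this expansion leaves fixed basis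
  directions with scalar coefficients.\<close>

lemma linear_basis_expansion:
  fixes f :: "'a::euclidean_space \<Rightarrow> 'b::real_vector"
  assumes "linear f"
  shows "(\<Sum>b\<in>Basis. (w \<bullet> b) *\<^sub>R f b) = f w"
proof -
  have "f (\<Sum>b\<in>Basis. (w \<bullet> b) *\<^sub>R b) = (\<Sum>b\<in>Basis. (w \<bullet> b) *\<^sub>R f b)"
    by (simp only: linear_sum[OF assms] linear_scale[OF assms])
  then show ?thesis
    unfolding euclidean_representation by (rule sym)
qed

lemma Ck_on_compose:
  assumes "open U" "open V" "Ck_on m f V" "Ck_on m g U" "g ` U \<subseteq> V"
  shows "Ck_on m (\<lambda>x. f (g x)) U"
  using assms(3,4)
proof (induction m arbitrary: f)
  case 0
  then show ?case using continuous_on_compose2 assms(5) by (metis Ck_on.simps(1))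
next
  case (Suc m)
  note df = Ck_on_has_derivative[OF Suc.prems(1)] and dg = Ck_on_has_derivative[OF Suc.prems(2)]
  show ?case
  proof (rule Ck_on_SucI[where f'="\<lambda>x v. \<Sum>b\<in>Basis. (frechet_derivative g (at x) v \<bullet> b) *\<^sub>R
      frechet_derivative f (at (g x)) b"])
    fix x assume x: "x \<in> U"
    have gx: "g x \<in> V" using x assms(5) by auto
    have "linear (frechet_derivative f (at (g x)))"
      using df[OF gx] has_derivative_linear by blast
    note eq = linear_basis_expansion[OF this]
    have "((\<lambda>x. f (g x)) has_derivative (\<lambda>v. frechet_derivative f (at (g x)) (frechet_derivative g (at x) v))) (at x)"
      by (rule has_derivative_compose[OF dg[OF x] df[OF gx]])
    then show "((\<lambda>x. f (g x)) has_derivative (\<lambda>v. \<Sum>b\<in>Basis. (frechet_derivative g (at x) v \<bullet> b) *\<^sub>R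
      frechet_derivative f (at (g x)) b)) (at x)" unfolding eq .
  next
    fix v
    have "Ck_on m (\<lambda>x. frechet_derivative f (at (g x)) b) U" for b
      using Suc.IH[of "\<lambda>y. frechet_derivative f (at y) b"] Suc.prems(1) Ck_on_SucD[OF Suc.prems(2)] by auto
    moreover have "Ck_on m (\<lambda>x. frechet_derivative g (at x) v \<bullet> b) U" for b
      using Ck_on_compose_linear[OF bounded_linear_inner_left assms(1), of m "\<lambda>x. frechet_derivative g (at x) v" b]
        Suc.prems(2) by simp
    ultimately show "Ck_on m (\<lambda>x. \<Sum>b\<in>Basis. (frechet_derivative g (at x) v \<bullet> b) *\<^sub>R
      frechet_derivative f (at (g x)) b) U"
      by (intro Ck_on_sum Ck_on_bilinear[OF bounded_bilinear_scaleR] assms) auto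
  qed (use assms in auto)
qed

lemma smooth_on_subset: "smooth_on U f \<Longrightarrow> V \<subseteq> U \<Longrightarrow> smooth_on V f"
  unfolding smooth_on_def using Ck_on_subset by blast

lemma smooth_on_cong:
  "open U \<Longrightarrow> (\<And>x. x \<in> U \<Longrightarrow> f x = g x) \<Longrightarrow> smooth_on U f \<Longrightarrow> smooth_on U g"
  unfolding smooth_on_def using Ck_on_cong by blast

lemma smooth_on_local:
  assumes "\<And>x. x \<in> U \<Longrightarrow> \<exists>V. open V \<and> x \<in> V \<and> smooth_on V f"
  shows "smooth_on U f"
  unfolding smooth_on_def using assms by (meson Ck_on_local smooth_on_def)

lemma smooth_on_imp_continuous_on: "smooth_on U f \<Longrightarrow> continuous_on U f"
  unfolding smooth_on_def by (metis Ck_on.simps(1))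

lemma smooth_on_has_derivative:
  "smooth_on U f \<Longrightarrow> x \<in> U \<Longrightarrow> (f has_derivative frechet_derivative f (at x)) (at x)"
  unfolding smooth_on_def using Ck_on_has_derivative by blast

lemma smooth_on_derivative: "smooth_on U f \<Longrightarrow> smooth_on U (\<lambda>x. frechet_derivative f (at x) v)"
  unfolding smooth_on_def by (metis Ck_on.simps(2))

lemma smooth_on_compose:
  "open U \<Longrightarrow> open V \<Longrightarrow> smooth_on V f \<Longrightarrow> smooth_on U g \<Longrightarrow> g ` U \<subseteq> V \<Longrightarrow> smooth_on U (\<lambda>x. f (g x))"
  unfolding smooth_on_def using Ck_on_compose by blast

lemma smooth_on_const: "smooth_on U (\<lambda>x. c)"
  unfolding smooth_on_def using Ck_on_const by blast

lemma smooth_on_bounded_linear: "bounded_linear f \<Longrightarrow> open U \<Longrightarrow> smooth_on U f"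
  unfolding smooth_on_def using Ck_on_bounded_linear by blast

lemma smooth_on_compose_linear:
  "bounded_linear l \<Longrightarrow> open U \<Longrightarrow> smooth_on U f \<Longrightarrow> smooth_on U (\<lambda>x. l (f x))"
  unfolding smooth_on_def using Ck_on_compose_linear by blast

lemma smooth_on_add: "open U \<Longrightarrow> smooth_on U f \<Longrightarrow> smooth_on U g \<Longrightarrow> smooth_on U (\<lambda>x. f x + g x)"
  unfolding smooth_on_def using Ck_on_add by blast

lemma smooth_on_bilinear:
  "bounded_bilinear b \<Longrightarrow> open U \<Longrightarrow> smooth_on U f \<Longrightarrow> smooth_on U g \<Longrightarrow> smooth_on U (\<lambda>x. b (f x) (g x))"
  unfolding smooth_on_def using Ck_on_bilinear by blast

lemmas smooth_on_scaleR = smooth_on_bilinear[OF bounded_bilinear_scaleR]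
  and smooth_on_mult = smooth_on_bilinear[OF bounded_bilinear_mult]
  and smooth_on_inner = smooth_on_bilinear[OF bounded_bilinear_inner]

lemma smooth_on_Pair:
  assumes "open U" "smooth_on U f" "smooth_on U g"
  shows "smooth_on U (\<lambda>x. (f x, g x))"
proof -
  have "smooth_on U (\<lambda>x. (f x, 0) + (0, g x))"
    using assms by (intro smooth_on_add smooth_on_compose_linear[of "\<lambda>y. (y, 0)"]
        smooth_on_compose_linear[of "\<lambda>y. (0, y)"]) (auto intro!: bounded_linear_intros)
  then show ?thesis by simp
qed

text \<open>The derivative of \<open>inverse\<close> is a polynomial in \<open>inverse\<close>
  itself, so each order of smoothness yields the next one.\<close>

lemma smooth_on_inverse:
  fixes f :: "'a::euclidean_space \<Rightarrow> real"
  assumes "open U" "smooth_on U f" "\<And>x. x \<in> U \<Longrightarrow> f x \<noteq> 0"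
  shows "smooth_on U (\<lambda>x. inverse (f x))"
proof -
  have op: "open (- {0::real})" by auto
  have "Ck_on m (inverse :: real \<Rightarrow> real) (- {0})" for m
  proof (induction m)
    case 0
    then show ?case by (auto intro!: continuous_intros)
  next
    case (Suc m)
    show ?case
    proof (rule Ck_on_SucI[where f'="\<lambda>x v. (- v) * (inverse x * inverse x)"])
      show "Ck_on m (\<lambda>x. (- v) * (inverse x * inverse x)) (- {0})" for v :: real
        by (intro Ck_on_bilinear[OF bounded_bilinear_mult] Ck_on_const Suc op)
    qed (auto intro!: derivative_eq_intros)
  qed
  then have "smooth_on (- {0}) (inverse :: real \<Rightarrow> real)" by (simp add: smooth_on_def)
  from smooth_on_compose[OF assms(1) op this assms(2)] show ?thesis
    using assms(3) by fastforce
qed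

text \<open>The index \<open>j\<close> makes the family closed under differentiation.\<close>

definition flat_exp :: "nat \<Rightarrow> real \<Rightarrow> real" where
  "flat_exp j x = (if x > 0 then inverse x ^ j * exp (- inverse x) else 0)"

lemma flat_exp_has_derivative:
  "(flat_exp j has_real_derivative flat_exp (Suc (Suc j)) x - real j * flat_exp (Suc j) x) (at x)"
proof (cases x "0::real" rule: linorder_cases)
  case less
  have "((\<lambda>x. 0) has_real_derivative 0) (at x)" by simp
  then have "(flat_exp j has_real_derivative 0) (at x)"
    by (rule has_field_derivative_transform_within_open[where S="{..<0}"])
      (use less in \<open>auto simp: flat_exp_def\<close>)
  with less show ?thesis by (simp add: flat_exp_def)
next
  case greater
  have "((\<lambda>x. inverse x ^ j * exp (- inverse x)) has_real_derivative
     flat_exp (Suc (Suc j)) x - real j * flat_exp (Suc j) x) (at x)"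
  proof (cases j)
    case 0
    then show ?thesis
      using greater by (auto intro!: derivative_eq_intros simp: flat_exp_def field_simps)
  next
    case (Suc i)
    have "((\<lambda>x. inverse x ^ Suc i) has_real_derivative - (real (Suc i) * inverse x ^ Suc (Suc i))) (at x)"
      using DERIV_power_Suc[OF DERIV_inverse[of x], of i] greater
      by (simp add: power2_eq_square algebra_simps)
    moreover have "((\<lambda>x. exp (- inverse x)) has_real_derivative exp (- inverse x) * inverse x ^ 2) (at x)"
      using greater by (auto intro!: derivative_eq_intros simp: power2_eq_square)
    ultimately show ?thesis
      using DERIV_mult greater
      by (fastforce simp: Suc flat_exp_def power2_eq_square algebra_simps)
  qed
  then show ?thesis
    by (rule has_field_derivative_transform_within_open[where S="{0<..}"])
      (use greater in \<open>auto simp: flat_exp_def\<close>)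
next
  case equal
  have "((\<lambda>h. (flat_exp j h - flat_exp j 0) / (h - 0)) \<longlongrightarrow> 0) (at 0)"
  proof (rule filterlim_split_at)
    show "((\<lambda>h. (flat_exp j h - flat_exp j 0) / (h - 0)) \<longlongrightarrow> 0) (at_left 0)"
      by (rule tendsto_eventually) (auto simp: flat_exp_def eventually_at_left_field intro: exI[of _ "-1"])
  next
    \<comment> \<open>With \<open>y = 1 / h\<close>, exponential decay beats every power of
      \<open>1 / h\<close>, so the right-hand difference quotient tends to \<open>0\<close> for
      every \<open>j\<close>.\<close>
    have "((\<lambda>y::real. y ^ Suc j / exp y) \<longlongrightarrow> 0) at_top"
      by (rule tendsto_power_div_exp_0)
    then have "((\<lambda>h::real. inverse h ^ Suc j / exp (inverse h)) \<longlongrightarrow> 0) (at_right 0)"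
      using filterlim_compose filterlim_inverse_at_top_right by blast
    moreover have "\<forall>\<^sub>F h in at_right (0::real). inverse h ^ Suc j / exp (inverse h) 
        = (flat_exp j h - flat_exp j 0) / (h - 0)"
      by (auto simp: flat_exp_def eventually_at_right_field field_simps exp_minus intro: exI[of _ "1"])
    ultimately show "((\<lambda>h. (flat_exp j h - flat_exp j 0) / (h - 0)) \<longlongrightarrow> 0) (at_right 0)"
      by (rule Lim_transform_eventually)
  qed
  with equal show ?thesis by (simp add: has_field_derivative_iff flat_exp_def)
qed

lemma smooth_flat_exp: "smooth_on UNIV (flat_exp j)"
proof -
  have "Ck_on m (flat_exp j) UNIV" for m
  proof (induction m arbitrary: j)
    case 0
    then show ?case
      using DERIV_isCont[OF flat_exp_has_derivative] by (auto intro!: continuous_at_imp_continuous_on)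
  next
    case (Suc m)
    show ?case
    proof (rule Ck_on_SucI[where
          f'="\<lambda>x v. v * (flat_exp (Suc (Suc j)) x + (- real j) * flat_exp (Suc j) x)"])
      show "(flat_exp j has_derivative (\<lambda>v. v * (flat_exp (Suc (Suc j)) x + (- real j) * flat_exp (Suc j) x))) (at x)" for x
        using flat_exp_has_derivative[of j x]
        by (simp add: has_field_derivative_def mult.commute[of _ "_ - _"])
    qed (intro Ck_on_bilinear[OF bounded_bilinear_mult] Ck_on_add Ck_on_const Suc open_UNIV, auto)
  qed
  then show ?thesis by (simp add: smooth_on_def)
qed

text \<open>Bootstrapping: the derivative of \<open>h\<close> is \<open>1 / g'\<close> composed with
  \<open>h\<close>, so \<open>m\<close> orders of smoothness of \<open>h\<close> give
  \<open>m + 1\<close>.\<close>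

lemma smooth_on_real_inverse_function:
  fixes g h :: "real \<Rightarrow> real"
  assumes g: "smooth_on UNIV g" "\<And>x. (g has_real_derivative g' x) (at x)" "\<And>x. g' x > 0"
    and h: "\<And>y. g (h y) = y"
  shows "smooth_on UNIV h"
proof -
  have mono: "g x < g y" if "x < y" for x y
    using DERIV_pos_imp_increasing[OF that] g(2,3) by blast
  have "h (g x) = x" for x
    using mono h by (metis linorder_neq_iff)
  have cont: "isCont h y" for y
  proof -
    have "isCont h (g (h y))"
      by (rule isCont_inverse_function[where d=1 and f=g])
        (use \<open>\<And>x. h (g x) = x\<close> DERIV_isCont[OF g(2)] in auto)
    then show ?thesis by (simp add: h)
  qed
  have der: "(h has_real_derivative inverse (g' (h y))) (at y)" for y
    by (rule DERIV_inverse_function[where f=g and a="y-1" and b="y+1"])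
      (use g h cont in \<open>auto simp: less_imp_neq[symmetric]\<close>)
  have g'eq: "g' x = frechet_derivative g (at x) 1" for x
    using fun_cong[OF frechet_derivative_at[OF g(2)[of x, unfolded has_field_derivative_def]], of 1] by simp
  have g'sm: "smooth_on UNIV (\<lambda>x. inverse (g' x))"
    using smooth_on_inverse[OF open_UNIV smooth_on_derivative[OF g(1), of 1]] g(3)
    by (simp add: less_imp_neq[symmetric] flip: g'eq)
  have "Ck_on m h UNIV" for m
  proof (induction m)
    case 0
    then show ?case using cont continuous_at_imp_continuous_on by auto
  next
    case (Suc m)
    show ?case
    proof (rule Ck_on_SucI[where f'="\<lambda>y v. v * inverse (g' (h y))"])
      have "Ck_on m (\<lambda>y. inverse (g' (h y))) UNIV"
        using Ck_on_compose[OF open_UNIV open_UNIV _ Suc, of "\<lambda>x. inverse (g' x)"] g'sm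
        by (auto simp: smooth_on_def)
      then show "Ck_on m (\<lambda>y. v * inverse (g' (h y))) UNIV" for v
        by (intro Ck_on_bilinear[OF bounded_bilinear_mult] Ck_on_const open_UNIV)
    qed (use der in \<open>auto simp: has_field_derivative_def mult.commute[of _ "inverse _"]\<close>)
  qed
  then show ?thesis by (simp add: smooth_on_def)
qed

section \<open>Shrinking a compact subset of a ball in the sphere\<close>

lemma smooth_on_ident: "open U \<Longrightarrow> smooth_on U (\<lambda>x. x)"
  by (rule smooth_on_bounded_linear[OF bounded_linear_ident])

lemma smooth_on_fst: "open U \<Longrightarrow> smooth_on U fst"
  by (rule smooth_on_bounded_linear[OF bounded_linear_fst])

lemma smooth_on_snd: "open U \<Longrightarrow> smooth_on U snd"
  by (rule smooth_on_bounded_linear[OF bounded_linear_snd])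

lemma smooth_on_diff:
  assumes "open U" "smooth_on U f" "smooth_on U g"
  shows "smooth_on U (\<lambda>x. f x - g x)"
  using smooth_on_add[OF assms(1,2) smooth_on_compose_linear[OF bounded_linear_minus[OF bounded_linear_ident] assms(1,3)]]
  by simp

lemma smooth_on_flat_exp: "open U \<Longrightarrow> smooth_on U f \<Longrightarrow> smooth_on U (\<lambda>x. flat_exp j (f x))"
  by (rule smooth_on_compose[OF _ open_UNIV smooth_flat_exp]) auto

lemmas smooth_on_intros = smooth_on_const smooth_on_ident smooth_on_fst smooth_on_snd smooth_on_add smooth_on_diff
  smooth_on_scaleR smooth_on_mult smooth_on_inner smooth_on_inverse smooth_on_flat_exp

section \<open>Smooth maps on arbitrary subsets\<close>

lemma smooth_map_onI:
  assumes "open U" "A \<subseteq> U" "smooth_on U f"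
  shows "smooth_map_on A f"
  unfolding smooth_map_on_def using assms by blast

lemma smooth_map_on_cong:
  "(\<And>x. x \<in> A \<Longrightarrow> f x = g x) \<Longrightarrow> smooth_map_on A f \<Longrightarrow> smooth_map_on A g"
  unfolding smooth_map_on_def by simp

lemma smooth_map_on_subset:
  assumes "smooth_map_on A f" "B \<subseteq> A"
  shows "smooth_map_on B f"
  unfolding smooth_map_on_def
proof
  fix x assume "x \<in> B"
  with assms(2) have "x \<in> A" by blast
  with assms(1) obtain U F where "open U" "x \<in> U" "smooth_on U F" "\<forall>y\<in>A \<inter> U. F y = f y"
    unfolding smooth_map_on_def by meson
  with assms(2) show "\<exists>U F. open U \<and> x \<in> U \<and> smooth_on U F \<and> (\<forall>y\<in>B \<inter> U. F y = f y)"
    by (intro exI[of _ U] exI[of _ F]) auto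
qed

lemma smooth_map_on_open:
  assumes "open U" "smooth_map_on U f"
  shows "smooth_on U f"
proof (rule smooth_on_local)
  fix x assume "x \<in> U"
  with assms(2) obtain V F where V: "open V" "x \<in> V" "smooth_on V F" "\<forall>y\<in>U \<inter> V. F y = f y"
    unfolding smooth_map_on_def by meson
  then have "smooth_on (U \<inter> V) f"
    using smooth_on_cong[of "U \<inter> V" F f] smooth_on_subset[of V F "U \<inter> V"] assms(1) by auto
  then show "\<exists>V. open V \<and> x \<in> V \<and> smooth_on V f"
    using V \<open>x \<in> U\<close> assms(1) by blast
qed

lemma smooth_map_on_imp_continuous_on:
  assumes "smooth_map_on A f"
  shows "continuous_on A f"
  unfolding continuous_on_eq_continuous_within
proof
  fix x assume x: "x \<in> A"
  with assms obtain V F where V: "open V" "x \<in> V" "smooth_on V F" "\<forall>y\<in>A \<inter> V. F y = f y"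
    unfolding smooth_map_on_def by meson
  have "isCont F x"
    using smooth_on_imp_continuous_on[OF V(3)] V(1,2) continuous_on_eq_continuous_at by blast
  then have "continuous (at x within A) F" by (rule continuous_at_imp_continuous_at_within)
  moreover have "\<forall>\<^sub>F y in at x within A. F y = f y"
    unfolding eventually_at_topological using V by blast
  ultimately show "continuous (at x within A) f"
    unfolding continuous_within using V x Lim_transform_eventually[of F "F x" "at x within A" f] by auto
qed

lemma smooth_map_on_compose:
  assumes "smooth_map_on A g" "smooth_map_on B f" "g ` A \<subseteq> B"
  shows "smooth_map_on A (\<lambda>x. f (g x))"
  unfolding smooth_map_on_def
proof
  fix x assume x: "x \<in> A"
  with assms(1) obtain U G where U: "open U" "x \<in> U" "smooth_on U G" "\<forall>y\<in>A \<inter> U. G y = g y"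
    unfolding smooth_map_on_def by meson
  from x assms(3) have "g x \<in> B" by blast
  with assms(2) obtain V F where V: "open V" "g x \<in> V" "smooth_on V F" "\<forall>y\<in>B \<inter> V. F y = f y"
    unfolding smooth_map_on_def by meson
  let ?U = "U \<inter> G -` V"
  have op: "open ?U"
    using continuous_open_preimage[OF smooth_on_imp_continuous_on] U V by blast
  have "smooth_on ?U (\<lambda>x. F (G x))"
    by (rule smooth_on_compose[OF op V(1,3)]) (use smooth_on_subset[OF U(3)] in auto)
  moreover have "\<forall>y\<in>A \<inter> ?U. F (G y) = f (g y)"
    using U V assms(3) by auto
  moreover have "x \<in> ?U" using U V x by auto
  ultimately show "\<exists>U F. open U \<and> x \<in> U \<and> smooth_on U F \<and> (\<forall>y\<in>A \<inter> U. F y = f (g y))"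
    using op by meson
qed

lemma smooth_map_on_Pair:
  assumes "smooth_map_on A f" "smooth_map_on A g"
  shows "smooth_map_on A (\<lambda>x. (f x, g x))"
  unfolding smooth_map_on_def
proof
  fix x assume x: "x \<in> A"
  with assms(1) obtain U F where U: "open U" "x \<in> U" "smooth_on U F" "\<forall>y\<in>A \<inter> U. F y = f y"
    unfolding smooth_map_on_def by meson
  from x assms(2) obtain V G where V: "open V" "x \<in> V" "smooth_on V G" "\<forall>y\<in>A \<inter> V. G y = g y"
    unfolding smooth_map_on_def by meson
  have "smooth_on (U \<inter> V) (\<lambda>x. (F x, G x))"
    using U V by (intro smooth_on_Pair) (auto intro: smooth_on_subset)
  then show "\<exists>U H. open U \<and> x \<in> U \<and> smooth_on U H \<and> (\<forall>y\<in>A \<inter> U. H y = (f y, g y))"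
    using U V by (intro exI[of _ "U \<inter> V"] exI[of _ "\<lambda>x. (F x, G x)"]) auto
qed

lemma smooth_map_on_local:
  assumes "\<And>x. x \<in> A \<Longrightarrow> \<exists>U. open U \<and> x \<in> U \<and> smooth_map_on (A \<inter> U) f"
  shows "smooth_map_on A f"
  unfolding smooth_map_on_def
proof
  fix x assume x: "x \<in> A"
  from assms[OF x] obtain U where U: "open U" "x \<in> U" "smooth_map_on (A \<inter> U) f" by auto
  with x obtain V F where V: "open V" "x \<in> V" "smooth_on V F" "\<forall>y\<in>A \<inter> U \<inter> V. F y = f y"
    unfolding smooth_map_on_def by (meson IntI)
  then show "\<exists>U F. open U \<and> x \<in> U \<and> smooth_on U F \<and> (\<forall>y\<in>A \<inter> U. F y = f y)"
    using U by (intro exI[of _ "U \<inter> V"] exI[of _ F]) (auto intro: smooth_on_subset)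
qed

lemma smooth_map_on_bounded_linear: "bounded_linear f \<Longrightarrow> smooth_map_on A f"
  by (rule smooth_map_onI[of UNIV]) (auto intro: smooth_on_bounded_linear)

lemma diffeomorphism_betwI:
  assumes "smooth_map_on A f" "smooth_map_on B g" "f ` A \<subseteq> B" "g ` B \<subseteq> A"
    and "\<And>x. x \<in> A \<Longrightarrow> g (f x) = x" "\<And>y. y \<in> B \<Longrightarrow> f (g y) = y"
  shows "diffeomorphism_betw A B f"
proof -
  have bij: "bij_betw f A B"
    by (rule bij_betw_byWitness[of _ g]) (use assms in auto)
  then have "inv_into A f y = g y" if "y \<in> B" for y
    using assms that by (metis bij_betw_inv_into_left image_subset_iff)
  then have "smooth_map_on B (inv_into A f)"
    using smooth_map_on_cong[OF _ assms(2)] by simp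
  with bij assms(1) show ?thesis by (simp add: diffeomorphism_betw_def)
qed

text \<open>The map is the identity for \<open>norm y ^ 2 \<ge> b\<close>.\<close>

definition shrink :: "real \<Rightarrow> real \<Rightarrow> 'a::euclidean_space \<Rightarrow> 'a" where
  "shrink \<kappa> b y = inverse (1 + \<kappa> * flat_exp 0 (b - y \<bullet> y)) *\<^sub>R y"

lemma flat_exp_nonneg: "flat_exp j x \<ge> 0"
  by (simp add: flat_exp_def)

lemma flat_exp_0_le_1: "flat_exp 0 x \<le> 1"
  by (simp add: flat_exp_def)

lemma flat_exp_0_mono: "x \<le> y \<Longrightarrow> flat_exp 0 x \<le> flat_exp 0 y"
  by (auto simp: flat_exp_def)

text \<open>The time enters squared so that the factor is nonnegative for every real time. The
  denominator then never vanishes, and the family is smooth on an open set around the time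
  interval.\<close>

lemma smooth_shrink: 
  assumes "c \<ge> 0"
  shows "smooth_on UNIV (\<lambda>p::real \<times> 'a::euclidean_space. shrink (c * (fst p * fst p)) b (snd p))"
proof -
  have "1 + c * (fst p * fst p) * flat_exp 0 (b - snd p \<bullet> snd p) \<noteq> 0" for p :: "real \<times> 'a"
    using mult_nonneg_nonneg[OF mult_nonneg_nonneg[OF assms zero_le_square] flat_exp_nonneg]
    by (smt (verit))
  then show ?thesis
    unfolding shrink_def by (intro smooth_on_intros open_UNIV)
qed

text \<open>In the radial variable \<open>u = norm y ^ 2\<close> the map \<open>shrink\<close> reads \<open>u / n(u) ^ 2\<close>. The bound
  \<open>b > 1/2\<close> makes this monotone for negative \<open>u\<close> as well, so that it is invertible on the whole line.\<close>

lemma radial_shrink_inverse: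
  fixes \<kappa> b :: real
  assumes "\<kappa> \<ge> 0" "1/2 < b"
  defines "n \<equiv> \<lambda>u. 1 + \<kappa> * flat_exp 0 (b - u)"
  obtains h where "smooth_on UNIV h" "\<And>y. h y * (inverse (n (h y)) * inverse (n (h y))) = y"
    "\<And>u. h (u * (inverse (n u) * inverse (n u))) = u"
proof -
  define g where "g = (\<lambda>u. u * (inverse (n u) * inverse (n u)))"
  define n' where "n' = (\<lambda>u. - \<kappa> * flat_exp 2 (b - u))"
  define g' where "g' = (\<lambda>u. (n u - 2 * u * n' u) * inverse (n u) ^ 3)"
  have n1: "n u \<ge> 1" for u
    using assms flat_exp_nonneg by (simp add: n_def)
  then have n0: "n u > 0" and nz: "n u \<noteq> 0" for u by (smt (verit))+
  have sn: "smooth_on UNIV n"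
    unfolding n_def by (intro smooth_on_intros open_UNIV)
  have sg: "smooth_on UNIV g"
    unfolding g_def
    by (intro smooth_on_intros sn nz open_UNIV)
  have dn: "(n has_real_derivative n' u) (at u)" for u
  proof -
    have "((\<lambda>u. flat_exp 0 (b - u)) has_real_derivative flat_exp 2 (b - u) * (- 1)) (at u)"
      by (rule DERIV_chain2[where f="flat_exp 0" and g="\<lambda>u. b - u"])
        (use flat_exp_has_derivative[of 0 "b - u"] in \<open>auto simp: numeral_2_eq_2 intro!: derivative_eq_intros\<close>)
    from DERIV_add[OF DERIV_const DERIV_cmult[OF this]] show ?thesis
      by (fastforce simp: n_def n'_def)
  qed
  have dg: "(g has_real_derivative g' u) (at u)" for u
    unfolding g_def g'_def
    using nz[of u] by (auto intro!: derivative_eq_intros dn simp: field_simps power3_eq_cube)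
  have pos: "g' u > 0" for u
  proof -
    have "0 \<le> flat_exp 0 (b - u) + 2 * u * flat_exp 2 (b - u)"
    proof (cases "b - u > 0")
      case True
      \<comment> \<open>Completing the square in \<open>(b - u) ^ 2 + 2 * u\<close> leaves the
        constant \<open>2 * b - 1\<close>; this is where \<open>b > 1/2\<close> enters.\<close>
      have "0 \<le> (u + (1 - b))\<^sup>2 + (2 * b - 1)" using assms(2) by (intro add_nonneg_nonneg) auto
      also have "\<dots> = (b - u)\<^sup>2 + 2 * u" by (simp add: power2_eq_square algebra_simps)
      finally have "0 \<le> ((b - u)\<^sup>2 + 2 * u) * flat_exp 2 (b - u)"
        by (intro mult_nonneg_nonneg flat_exp_nonneg)
      moreover have "(b - u)\<^sup>2 * flat_exp 2 (b - u) = flat_exp 0 (b - u)"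
        using True by (simp add: flat_exp_def field_simps)
      ultimately show ?thesis by (simp add: algebra_simps)
    next
      case False
      then show ?thesis by (simp add: flat_exp_def)
    qed
    then have "0 \<le> \<kappa> * (flat_exp 0 (b - u) + 2 * u * flat_exp 2 (b - u))"
      using assms(1) by simp
    then have "n u - 2 * u * n' u > 0" by (simp add: n_def n'_def algebra_simps)
    then show ?thesis using n0[of u] by (simp add: g'_def)
  qed
  have "\<exists>u. g u = y" for y
  proof -
    \<comment> \<open>Brackets for the intermediate value theorem: \<open>n\<close> is at most
      \<open>1 + \<kappa>\<close>, so
      \<open>g l \<le> l / (1 + \<kappa>) ^ 2 = - \<bar>y\<bar>\<close>; beyond \<open>b\<close> the
      function \<open>g\<close> is the identity.\<close>
    define l where "l = - \<bar>y\<bar> * (1 + \<kappa>)\<^sup>2"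
    define r where "r = max b \<bar>y\<bar>"
    have "n l \<le> 1 + \<kappa>"
      using mult_left_mono[OF flat_exp_0_le_1 assms(1)] by (simp add: n_def)
    then have "(n l)\<^sup>2 \<le> (1 + \<kappa>)\<^sup>2" using n0[of l] by (intro power_mono) auto
    then have "\<bar>y\<bar> * (n l)\<^sup>2 \<le> \<bar>y\<bar> * (1 + \<kappa>)\<^sup>2" by (intro mult_left_mono) auto
    then have "g l \<le> - \<bar>y\<bar>"
      using n0[of l] by (simp add: g_def l_def field_simps power2_eq_square)
    then have 1: "g l \<le> y" by simp
    have "flat_exp 0 (b - r) = 0" by (simp add: flat_exp_def r_def)
    then have "g r = r" by (simp add: g_def n_def)
    then have 2: "y \<le> g r" by (simp add: r_def)
    have "l \<le> 0" by (simp add: l_def)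
    then have 3: "l \<le> r" using assms(2) by (simp add: r_def)
    have "continuous_on {l..r} g"
      using dg by (meson DERIV_isCont continuous_at_imp_continuous_on)
    then show ?thesis using IVT'[OF 1 2 3] by blast
  qed
  then obtain h where h: "\<And>y. g (h y) = y" by metis
  have "h (g u) = u" for u
    using h DERIV_pos_imp_increasing[of _ _ g] dg pos by (metis linorder_neq_iff)
  with that h smooth_on_real_inverse_function[OF sg dg pos h] show thesis
    by (simp add: g_def)
qed

text \<open>The map is radial, so \<open>h\<close> recovers the original squared norm and
  multiplication by \<open>n\<close> at that value undoes the rescaling. The inverse is again
  radial, which later keeps it inside the subspace \<open>W\<close>.\<close>

lemma shrink_inverse:
  assumes "\<kappa> \<ge> 0" "1/2 < b"
  obtains \<tau> :: "'a::euclidean_space \<Rightarrow> 'a" where "smooth_on UNIV \<tau>" "\<And>y. \<tau> (shrink \<kappa> b y) = y" "\<And>y. shrink \<kappa> b (\<tau> y) = y"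
    "\<And>y. \<exists>c. \<tau> y = c *\<^sub>R y"
proof -
  let ?n = "\<lambda>u. 1 + \<kappa> * flat_exp 0 (b - u)"
  obtain h where h: "smooth_on UNIV h" "\<And>y. h y * (inverse (?n (h y)) * inverse (?n (h y))) = y"
    "\<And>u. h (u * (inverse (?n u) * inverse (?n u))) = u"
    using radial_shrink_inverse[OF assms] by metis
  have nz: "?n u \<noteq> 0" for u
    using mult_nonneg_nonneg[OF assms(1) flat_exp_nonneg] by (smt (verit))
  define \<tau> where "\<tau> = (\<lambda>y::'a. ?n (h (y \<bullet> y)) *\<^sub>R y)"
  show thesis
  proof (rule that)
    have "smooth_on UNIV (\<lambda>y::'a. h (y \<bullet> y))"
      by (rule smooth_on_compose[OF open_UNIV open_UNIV h(1)])
        (auto intro!: smooth_on_intros)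
    then show "smooth_on UNIV \<tau>"
      unfolding \<tau>_def by (intro smooth_on_intros open_UNIV)
    show "\<tau> (shrink \<kappa> b y) = y" for y
    proof -
      have "shrink \<kappa> b y \<bullet> shrink \<kappa> b y = (y \<bullet> y) * (inverse (?n (y \<bullet> y)) * inverse (?n (y \<bullet> y)))"
        by (simp add: shrink_def)
      then have "h (shrink \<kappa> b y \<bullet> shrink \<kappa> b y) = y \<bullet> y" using h(3) by simp
      then show ?thesis using nz[of "y \<bullet> y"] by (simp add: \<tau>_def) (simp add: shrink_def)
    qed
    show "shrink \<kappa> b (\<tau> y) = y" for y
    proof -
      let ?v = "h (y \<bullet> y)"
      have "\<tau> y \<bullet> \<tau> y = (?n ?v * ?n ?v) * (?v * (inverse (?n ?v) * inverse (?n ?v)))"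
        unfolding h(2) by (simp add: \<tau>_def)
      moreover have "(m * m) * (v * (inverse m * inverse m)) = v" if "m \<noteq> 0" for m v :: real
        using that by (simp add: field_simps)
      ultimately have "\<tau> y \<bullet> \<tau> y = ?v" using nz[of ?v] by simp
      then show ?thesis using nz[of ?v] by (simp add: shrink_def) (simp add: \<tau>_def)
    qed
  qed (auto simp: \<tau>_def)
qed

section \<open>Transplanting self-maps of a disc to the sphere\<close>

definition extend_by_id :: "('a \<Rightarrow> 'b) \<Rightarrow> 'a set \<Rightarrow> 'b set \<Rightarrow> ('a \<Rightarrow> 'a) \<Rightarrow> 'b \<Rightarrow> 'b" where
  "extend_by_id f A B \<sigma> x = (if x \<in> B then f (\<sigma> (inv_into A f x)) else x)"

lemma extend_by_id_image:
  assumes "bij_betw f A B" "B \<subseteq> S" "\<And>y. y \<in> A \<Longrightarrow> \<sigma> y \<in> A" "x \<in> S"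
  shows "extend_by_id f A B \<sigma> x \<in> S"
  using assms by (auto simp: extend_by_id_def bij_betw_def inv_into_into)

lemma extend_by_id_inverse:
  assumes "bij_betw f A B" "\<And>y. y \<in> A \<Longrightarrow> \<sigma> y \<in> A" "\<And>y. y \<in> A \<Longrightarrow> \<tau> (\<sigma> y) = y"
  shows "extend_by_id f A B \<tau> (extend_by_id f A B \<sigma> x) = x"
  using assms by (auto simp: extend_by_id_def bij_betw_def inv_into_into f_inv_into_f)

lemma smooth_extend_by_id:
  fixes f :: "'a::euclidean_space \<Rightarrow> 'b::euclidean_space"
    and \<sigma> :: "'p::euclidean_space \<times> 'a \<Rightarrow> 'a"
  assumes f: "diffeomorphism_betw A B f" and B: "openin (top_of_set S) B"
    and K: "compact K" "K \<subseteq> A"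
    and \<sigma>: "smooth_on UNIV \<sigma>" "\<And>t y. y \<in> A \<Longrightarrow> \<sigma> (t, y) \<in> A" "\<And>t y. y \<in> A \<Longrightarrow> y \<notin> K \<Longrightarrow> \<sigma> (t, y) = y"
  shows "smooth_map_on (UNIV \<times> S) (\<lambda>p. extend_by_id f A B (\<lambda>y. \<sigma> (fst p, y)) (snd p))"
proof (rule smooth_map_on_local)
  let ?h = "\<lambda>p. extend_by_id f A B (\<lambda>y. \<sigma> (fst p, y)) (snd p)"
  let ?\<theta> = "inv_into A f"
  have bij: "bij_betw f A B" and sf: "smooth_map_on A f" and sth: "smooth_map_on B ?\<theta>"
    using f by (auto simp: diffeomorphism_betw_def)
  have \<theta>A: "?\<theta> x \<in> A" and f\<theta>: "f (?\<theta> x) = x" if "x \<in> B" for x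
    using bij that by (auto simp: bij_betw_def inv_into_into f_inv_into_f)
  fix p :: "'p \<times> 'b" assume p: "p \<in> UNIV \<times> S"
  show "\<exists>U. open U \<and> p \<in> U \<and> smooth_map_on (UNIV \<times> S \<inter> U) ?h"
  proof (cases "snd p \<in> B")
    case True
    obtain O' where O': "open O'" "B = S \<inter> O'" using B by (auto simp: openin_open)
    have eq: "(UNIV \<times> S) \<inter> (UNIV \<times> O') = (UNIV :: 'p set) \<times> B" using O' by auto
    have "smooth_map_on (UNIV \<times> B) (\<lambda>p::'p \<times> 'b. ?\<theta> (snd p))"
      by (rule smooth_map_on_compose[OF smooth_map_on_bounded_linear[OF bounded_linear_snd] sth]) auto
    then have "smooth_map_on (UNIV \<times> B) (\<lambda>p::'p \<times> 'b. (fst p, ?\<theta> (snd p)))"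
      by (intro smooth_map_on_Pair smooth_map_on_bounded_linear[OF bounded_linear_fst])
    then have "smooth_map_on (UNIV \<times> B) (\<lambda>p::'p \<times> 'b. \<sigma> (fst p, ?\<theta> (snd p)))"
      by (rule smooth_map_on_compose[where B=UNIV]) (auto intro: smooth_map_onI \<sigma>(1))
    then have "smooth_map_on (UNIV \<times> B) (\<lambda>p::'p \<times> 'b. f (\<sigma> (fst p, ?\<theta> (snd p))))"
      by (rule smooth_map_on_compose[OF _ sf]) (use \<sigma>(2) \<theta>A in auto)
    then have "smooth_map_on (UNIV \<times> B) ?h"
      by (rule smooth_map_on_cong[rotated]) (auto simp: extend_by_id_def)
    then show ?thesis
      using O' p True by (intro exI[of _ "UNIV \<times> O'"]) (auto simp: eq open_Times)
  next
    case False
    have "compact (f ` K)"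
      using compact_continuous_image K smooth_map_on_imp_continuous_on[OF smooth_map_on_subset[OF sf]] by blast
    then have op: "open (UNIV \<times> (- (f ` K)) :: ('p \<times> 'b) set)"
      by (intro open_Times) (auto simp: compact_imp_closed)
    have "smooth_map_on (UNIV \<times> S \<inter> UNIV \<times> (- (f ` K))) (\<lambda>p::'p \<times> 'b. snd p)"
      by (intro smooth_map_on_bounded_linear bounded_linear_intros)
    then have "smooth_map_on (UNIV \<times> S \<inter> UNIV \<times> (- (f ` K))) ?h"
    proof (rule smooth_map_on_cong[rotated])
      fix q :: "'p \<times> 'b" assume "q \<in> UNIV \<times> S \<inter> UNIV \<times> (- (f ` K))"
      then have "snd q \<in> B \<Longrightarrow> ?\<theta> (snd q) \<notin> K" using f\<theta> by (metis ComplD IntD2 imageI mem_Times_iff)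
      then show "snd q = ?h q" by (simp add: extend_by_id_def \<sigma>(3) f\<theta> \<theta>A)
    qed
    moreover have "p \<in> UNIV \<times> (- (f ` K))"
      using False K bij by (auto simp: bij_betw_def mem_Times_iff)
    ultimately show ?thesis using op by blast
  qed
qed

text \<open>In the disc parametrising \<open>B\<close> the compact preimage of \<open>L\<close> is
  pulled radially towards the centre by \<open>shrink\<close>, which is the identity near the rim
  and therefore extends to the whole sphere.\<close>

lemma sphere_isotopy_into_neighbourhood:
  fixes f :: "'a::euclidean_space \<Rightarrow> 'a"
  assumes f: "diffeomorphism_betw (W \<inter> ball 0 1) B f" and W: "subspace W"
    and B: "openin (top_of_set (sphere 0 1)) B"
    and L: "compact L" "L \<subseteq> B" and N: "open N" "f 0 \<in> N"
  obtains h where "sphere_isotopy h" "\<And>x. x \<in> L \<Longrightarrow> h (1, x) \<in> N"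
    "\<And>x. x \<notin> B \<Longrightarrow> h (1, x) = x"
proof -
  let ?A = "W \<inter> ball 0 1"
  let ?\<theta> = "inv_into ?A f"
  have bij: "bij_betw f ?A B" and sf: "smooth_map_on ?A f" and sth: "smooth_map_on B ?\<theta>"
    using f by (auto simp: diffeomorphism_betw_def)
  have BS: "B \<subseteq> sphere 0 1" using B openin_imp_subset by blast
  have \<theta>A: "?\<theta> x \<in> ?A" if "x \<in> B" for x
    using bij that by (metis bij_betw_def inv_into_into)
  have "compact (?\<theta> ` L)"
    using compact_continuous_image[OF continuous_on_subset[OF smooth_map_on_imp_continuous_on[OF sth] L(2)] L(1)] .
  then have "compact (norm ` ?\<theta> ` L)"
    by (rule compact_continuous_image[rotated]) (intro continuous_intros)
  have "\<exists>r<1. \<forall>y\<in>?\<theta> ` L. norm y \<le> r"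
  proof (cases "L = {}")
    case False
    then obtain y where "y \<in> ?\<theta> ` L" "\<forall>z\<in>?\<theta> ` L. norm z \<le> norm y"
      using compact_attains_sup[OF \<open>compact (norm ` ?\<theta> ` L)\<close>] by auto
    moreover from this(1) have "norm y < 1" using \<theta>A L(2) by auto
    ultimately show ?thesis by blast
  qed (auto intro: exI[of _ 0])
  then obtain r0 where r0: "r0 < 1" "\<forall>y\<in>?\<theta> ` L. norm y \<le> r0" by blast
  \<comment> \<open>Enlarging the radius to \<open>3/4\<close> makes \<open>r ^ 2\<close> exceed
    \<open>1/2\<close>, so that the \<open>b\<close> chosen below meets the bound that
    \<open>shrink_inverse\<close> requires.\<close>
  define r where "r = max r0 (3/4)"
  have r: "r < 1" "r \<ge> 3/4" and rL: "\<And>x. x \<in> L \<Longrightarrow> norm (?\<theta> x) \<le> r"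
    using r0 by (auto simp: r_def le_max_iff_disj)
  have r2: "r\<^sup>2 < 1" "r\<^sup>2 > 1/2"
    using r power_strict_mono[of r 1 2] power_mono[of "3/4" r 2] by (auto simp: power2_eq_square)
  \<comment> \<open>Strictly between \<open>r ^ 2\<close> and \<open>1\<close>: the shrinking acts
    with strength at least \<open>E > 0\<close> on the preimage of \<open>L\<close>, yet stops
    before the rim.\<close>
  define b where "b = (1 + r\<^sup>2) / 2"
  have b: "1/2 < b" "b < 1" "r\<^sup>2 < b" using r2 by (auto simp: b_def)
  have "continuous_on ?A f" using sf by (rule smooth_map_on_imp_continuous_on)
  moreover have 0: "0 \<in> ?A" using W subspace_0 by auto
  ultimately obtain \<epsilon> where \<epsilon>: "\<epsilon> > 0" "\<And>y. y \<in> ?A \<Longrightarrow> norm y < \<epsilon> \<Longrightarrow> f y \<in> N"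
  proof -
    obtain e where "e > 0" "ball (f 0) e \<subseteq> N" using N open_contains_ball by blast
    moreover obtain d where "d > 0" "\<forall>y\<in>?A. dist y 0 < d \<longrightarrow> dist (f y) (f 0) < e"
      using \<open>continuous_on ?A f\<close> 0 \<open>e > 0\<close> unfolding continuous_on_iff by blast
    ultimately show thesis by (intro that[of d]) (auto simp: dist_commute subset_iff)
  qed
  define E where "E = flat_exp 0 (b - r\<^sup>2)"
  have E: "E > 0" using b by (simp add: E_def flat_exp_def)
  \<comment> \<open>At time \<open>1\<close> norms up to \<open>r\<close>, which are less than
    \<open>1\<close>, get divided by at least \<open>1 + 1 / \<epsilon>\<close>, which brings them
    below \<open>\<epsilon>\<close>.\<close>
  define c where "c = inverse (\<epsilon> * E)"
  have c: "c \<ge> 0" "c * E = inverse \<epsilon>" using E \<epsilon> by (auto simp: c_def field_simps)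
  define \<sigma> :: "real \<times> 'a \<Rightarrow> 'a" where "\<sigma> = (\<lambda>p. shrink (c * (fst p * fst p)) b (snd p))"
  define K where "K = W \<inter> cball 0 (sqrt b)"
  have sb: "sqrt b < 1" using b by simp
  have K: "compact K" "K \<subseteq> ?A"
    using closed_Int_compact[OF closed_subspace[OF W] compact_cball[of 0 "sqrt b"]] order_le_less_trans[OF _ sb]
    by (auto simp: K_def)
  have norm_shrink: "norm (shrink \<kappa> b y) \<le> norm y" if "\<kappa> \<ge> 0" for \<kappa> and y :: 'a
  proof -
    have "1 + \<kappa> * flat_exp 0 (b - y \<bullet> y) \<ge> 1" using that flat_exp_nonneg by simp
    then show ?thesis by (simp add: shrink_def mult_left_le_one_le inverse_le_1_iff)
  qed
  have shrink_A: "shrink \<kappa> b y \<in> ?A" if "\<kappa> \<ge> 0" "y \<in> ?A" for \<kappa> y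
    using norm_shrink[OF that(1), of y] that(2) W by (auto simp: shrink_def subspace_scale)
  have shrink_id: "shrink \<kappa> b y = y" if "sqrt b < norm y" for \<kappa> and y :: 'a
  proof -
    have "b < (norm y)\<^sup>2" using power_strict_mono[OF that, of 2] b by simp
    then show ?thesis by (simp add: shrink_def flat_exp_def power2_norm_eq_inner)
  qed
  have sq: "c * (t * t) \<ge> 0" for t using c by simp

  define h where "h = (\<lambda>p. extend_by_id f ?A B (\<lambda>y. \<sigma> (fst p, y)) (snd p))"
  have ht: "h (t, x) = extend_by_id f ?A B (shrink (c * (t * t)) b) x" for t x
    by (simp add: h_def \<sigma>_def)
  have slice: "smooth_map_on S (\<lambda>x. H (t, x))" if "smooth_map_on (UNIV \<times> S) H"
    for H :: "real \<times> 'a \<Rightarrow> 'a" and S t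
    by (rule smooth_map_on_compose[OF smooth_map_on_Pair[OF smooth_map_onI[OF open_UNIV subset_UNIV smooth_on_const]
            smooth_map_onI[OF open_UNIV subset_UNIV smooth_on_ident[OF open_UNIV]]] that]) auto
  have sh: "smooth_map_on (UNIV \<times> sphere 0 1) h"
    unfolding h_def
  proof (rule smooth_extend_by_id[OF f B K])
    show "smooth_on UNIV \<sigma>" unfolding \<sigma>_def using smooth_shrink[OF c(1)] .
  qed (use shrink_A[OF sq] shrink_id in \<open>auto simp: \<sigma>_def K_def\<close>)
  have diffeo: "diffeomorphism_betw (sphere 0 1) (sphere 0 1) (\<lambda>x. h (t, x))" for t
  proof -
    obtain \<tau> :: "'a \<Rightarrow> 'a" where \<tau>: "smooth_on UNIV \<tau>" "\<And>y. \<tau> (shrink (c * (t * t)) b y) = y"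
      "\<And>y. shrink (c * (t * t)) b (\<tau> y) = y" "\<And>y. \<exists>d. \<tau> y = d *\<^sub>R y"
      using shrink_inverse[OF sq b(1)] by metis
    have \<tau>A: "\<tau> y \<in> ?A" if "y \<in> ?A" for y
    proof -
      \<comment> \<open>If \<open>\<tau> y\<close> lay beyond radius \<open>sqrt b\<close>, then
        \<open>shrink\<close> would fix it, so \<open>\<tau> y = y\<close>, which has norm below
        \<open>1\<close>.\<close>
      have "norm (\<tau> y) < 1"
        using shrink_id[of "\<tau> y" "c * (t * t)"] \<tau>(3)[of y] that order_le_less_trans[OF _ sb]
        by (cases "sqrt b < norm (\<tau> y)") auto
      then show ?thesis using \<tau>(4)[of y] that W by (auto simp: subspace_scale)
    qed
    have "\<tau> y = y" if "sqrt b < norm y" for y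
      using \<tau>(2)[of y] shrink_id[OF that] by simp
    \<comment> \<open>The inverse at a fixed time is treated as a family constant in an auxiliary
      time, from which one slice is taken.\<close>
    then have "smooth_map_on (UNIV \<times> sphere 0 1)
      (\<lambda>p::real \<times> 'a. extend_by_id f ?A B (\<lambda>y. (\<lambda>q. \<tau> (snd q)) (fst p, y)) (snd p))"
      using \<tau>A smooth_on_compose[OF open_UNIV open_UNIV \<tau>(1) smooth_on_snd[OF open_UNIV]]
      by (intro smooth_extend_by_id[OF f B K]) (auto simp: K_def)
    from slice[OF this] have s\<tau>: "smooth_map_on (sphere 0 1) (extend_by_id f ?A B \<tau>)" by simp
    show ?thesis
      using slice[OF sh, of t] unfolding ht
    proof (rule diffeomorphism_betwI[OF _ s\<tau>])
      show "extend_by_id f ?A B (shrink (c * (t * t)) b) ` sphere 0 1 \<subseteq> sphere 0 1"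
        using extend_by_id_image[OF bij BS, of "shrink (c * (t * t)) b"] shrink_A[OF sq] by blast
      show "extend_by_id f ?A B \<tau> ` sphere 0 1 \<subseteq> sphere 0 1"
        using extend_by_id_image[OF bij BS, of \<tau>] \<tau>A by blast
    qed (rule extend_by_id_inverse[OF bij], rule shrink_A[OF sq] \<tau>A, assumption, rule \<tau>)+
  qed
  show thesis
  proof (rule that[of h])
    show "sphere_isotopy h"
      unfolding sphere_isotopy_def
    proof (intro conjI ballI)
      show "smooth_map_on ({0..1} \<times> sphere 0 1) h"
        by (rule smooth_map_on_subset[OF sh]) auto
      show "h (0, x) = x" for x
        using bij by (auto simp: ht extend_by_id_def shrink_def bij_betw_def f_inv_into_f)
    qed (rule diffeo)
  next
    fix x assume x: "x \<in> L"
    let ?y = "?\<theta> x" and ?e = "flat_exp 0 (b - ?\<theta> x \<bullet> ?\<theta> x)"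
    have yA: "?y \<in> ?A" using x L \<theta>A by auto
    have "?y \<bullet> ?y \<le> r\<^sup>2"
      using rL[OF x] by (simp add: power_mono flip: power2_norm_eq_inner)
    then have "E \<le> ?e" unfolding E_def by (intro flat_exp_0_mono) simp
    then have le: "inverse \<epsilon> \<le> c * ?e" using mult_left_mono[OF _ c(1)] c(2) by metis
    then have pos: "1 + c * ?e > 0" using \<epsilon>(1) positive_imp_inverse_positive[OF \<epsilon>(1)] by linarith
    have "norm (shrink c b ?y) = norm ?y / (1 + c * ?e)"
      using pos by (simp add: shrink_def divide_inverse)
    also have "\<dots> < \<epsilon>"
    proof -
      have "norm ?y \<le> 1" using yA by auto
      also have "1 \<le> \<epsilon> * (c * ?e)" using le \<epsilon>(1) by (simp add: field_simps)
      also have "\<dots> < \<epsilon> * (1 + c * ?e)" using \<epsilon>(1) by (simp add: algebra_simps)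
      finally show ?thesis using pos by (simp add: divide_less_eq)
    qed
    finally show "h (1, x) \<in> N"
      using \<epsilon>(2) shrink_A[OF c(1) yA] x L by (auto simp: ht extend_by_id_def)
  next
    show "h (1, x) = x" if "x \<notin> B" for x
      using that by (simp add: ht extend_by_id_def)
  qed
qed

section \<open>Tangent spaces and tangent fields in slice charts\<close>

text \<open>Between open sets \<open>smooth_map_on\<close> reduces to \<open>smooth_on\<close>, so a
  chart from \<open>smooth_submanifold\<close> is kept as a pair of mutually inverse smooth
  maps.\<close>

locale slice_chart =
  fixes S U V W :: "'a::euclidean_space set" and \<phi> \<psi> :: "'a \<Rightarrow> 'a"
  assumes open_U: "open U" and open_V: "open V"
    and \<phi>: "smooth_on U \<phi>" and \<psi>: "smooth_on V \<psi>"
    and \<phi>_in: "\<And>x. x \<in> U \<Longrightarrow> \<phi> x \<in> V" and \<psi>_in: "\<And>y. y \<in> V \<Longrightarrow> \<psi> y \<in> U"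
    and \<psi>\<phi>: "\<And>x. x \<in> U \<Longrightarrow> \<psi> (\<phi> x) = x" and \<phi>\<psi>: "\<And>y. y \<in> V \<Longrightarrow> \<phi> (\<psi> y) = y"
    and W: "subspace W" and slice: "\<phi> ` (S \<inter> U) = W \<inter> V"
begin

abbreviation "D\<phi> x \<equiv> frechet_derivative \<phi> (at x)"
abbreviation "D\<psi> y \<equiv> frechet_derivative \<psi> (at y)"

lemma D\<phi>: "x \<in> U \<Longrightarrow> (\<phi> has_derivative D\<phi> x) (at x)"
  and D\<psi>: "y \<in> V \<Longrightarrow> (\<psi> has_derivative D\<psi> y) (at y)"
  using smooth_on_has_derivative \<phi> \<psi> by blast+

lemma linear_D\<phi>: "x \<in> U \<Longrightarrow> linear (D\<phi> x)"
  and linear_D\<psi>: "y \<in> V \<Longrightarrow> linear (D\<psi> y)"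
  using D\<phi> D\<psi> has_derivative_linear by blast+

lemma D\<phi>_D\<psi>:
  assumes "x \<in> U" shows "D\<phi> x (D\<psi> (\<phi> x) v) = v"
proof -
  have "((\<lambda>y. \<phi> (\<psi> y)) has_derivative (\<lambda>v. D\<phi> x (D\<psi> (\<phi> x) v))) (at (\<phi> x))"
    using has_derivative_compose[OF D\<psi>[OF \<phi>_in[OF assms]], of \<phi>] D\<phi> assms by (simp add: \<psi>\<phi>)
  then have "((\<lambda>y. y) has_derivative (\<lambda>v. D\<phi> x (D\<psi> (\<phi> x) v))) (at (\<phi> x))"
    by (rule has_derivative_transform_within_open[OF _ open_V \<phi>_in[OF assms]]) (rule \<phi>\<psi>)
  from has_derivative_unique[OF this has_derivative_ident] show ?thesis by metis
qed

lemma D\<psi>_D\<phi>: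
  assumes "x \<in> U" shows "D\<psi> (\<phi> x) (D\<phi> x v) = v"
proof -
  have "((\<lambda>x. \<psi> (\<phi> x)) has_derivative (\<lambda>v. D\<psi> (\<phi> x) (D\<phi> x v))) (at x)"
    using has_derivative_compose[OF D\<phi>[OF assms] D\<psi>[OF \<phi>_in[OF assms]]] .
  then have "((\<lambda>x. x) has_derivative (\<lambda>v. D\<psi> (\<phi> x) (D\<phi> x v))) (at x)"
    by (rule has_derivative_transform_within_open[OF _ open_U assms]) (rule \<psi>\<phi>)
  from has_derivative_unique[OF this has_derivative_ident] show ?thesis by metis
qed

lemma \<phi>_slice: "x \<in> S \<Longrightarrow> x \<in> U \<Longrightarrow> \<phi> x \<in> W"
  using slice by blast

lemma \<psi>_slice: "y \<in> W \<Longrightarrow> y \<in> V \<Longrightarrow> \<psi> y \<in> S"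
  using slice \<psi>\<phi> by (metis (no_types, lifting) IntI IntE image_iff)

lemma coordinate_line:
  assumes "q \<in> S" "q \<in> U" "w \<in> W"
  obtains \<epsilon> where "\<epsilon> > 0" "\<And>t. t \<in> {-\<epsilon><..<\<epsilon>} \<Longrightarrow> \<phi> q + t *\<^sub>R w \<in> V"
    "\<And>t. t \<in> {-\<epsilon><..<\<epsilon>} \<Longrightarrow> \<psi> (\<phi> q + t *\<^sub>R w) \<in> S"
proof -
  obtain e where e: "e > 0" "ball (\<phi> q) e \<subseteq> V"
    using open_V \<phi>_in[OF assms(2)] open_contains_ball by blast
  \<comment> \<open>Adding \<open>1\<close> to the norm covers the case
    \<open>w = 0\<close>.\<close>
  define \<epsilon> where "\<epsilon> = e / (1 + norm w)"
  have "\<epsilon> > 0" using e by (simp add: \<epsilon>_def add_pos_nonneg)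
  have inV: "\<phi> q + t *\<^sub>R w \<in> V" if "t \<in> {-\<epsilon><..<\<epsilon>}" for t
  proof -
    have "\<bar>t\<bar> * norm w \<le> \<bar>t\<bar> * (1 + norm w)" by (intro mult_left_mono) auto
    also have "\<dots> < e" using that by (auto simp: \<epsilon>_def field_simps abs_if add_pos_nonneg)
    finally show ?thesis using e by (auto simp: dist_norm subset_iff)
  qed
  moreover have "\<psi> (\<phi> q + t *\<^sub>R w) \<in> S" if "t \<in> {-\<epsilon><..<\<epsilon>}" for t
    using inV[OF that] \<phi>_slice assms W by (intro \<psi>_slice) (auto intro!: subspace_add subspace_scale)
  ultimately show thesis using that \<open>\<epsilon> > 0\<close> by blast
qed

lemma coordinate_line_derivative:
  assumes "\<phi> q + t *\<^sub>R w \<in> V"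
  shows "((\<lambda>t. \<psi> (\<phi> q + t *\<^sub>R w)) has_vector_derivative D\<psi> (\<phi> q + t *\<^sub>R w) w) (at t)"
proof -
  have "((\<lambda>t. \<phi> q + t *\<^sub>R w) has_derivative (\<lambda>s. s *\<^sub>R w)) (at t)"
    by (auto intro!: derivative_eq_intros)
  from has_derivative_compose[OF this D\<psi>[OF assms]] show ?thesis
    using linear_D\<psi>[OF assms] by (simp add: has_vector_derivative_def linear_scale)
qed

text \<open>The derivative is a limit of difference quotients in \<open>W\<close>, and subspaces of
  a Euclidean space are closed.\<close>

lemma curve_derivative_slice:
  fixes c :: "real \<Rightarrow> 'a"
  assumes "\<epsilon> > 0" "\<And>t. t \<in> {-\<epsilon><..<\<epsilon>} \<Longrightarrow> c t \<in> W" "(c has_vector_derivative d) (at 0)"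
  shows "d \<in> W"
proof -
  have c0: "c 0 \<in> W" using assms by auto
  have lim: "((\<lambda>t. inverse t *\<^sub>R (c t - c 0)) \<longlongrightarrow> d) (at 0)"
  proof -
    have "((\<lambda>t. norm (c t - c 0 - t *\<^sub>R d) / \<bar>t\<bar>) \<longlongrightarrow> 0) (at 0)"
      using assms(3) by (auto simp: has_vector_derivative_def has_derivative_at)
    moreover have "\<forall>\<^sub>F t in at 0. norm (c t - c 0 - t *\<^sub>R d) / \<bar>t\<bar> = norm (inverse t *\<^sub>R (c t - c 0) - d)"
    proof (rule eventually_at_topological[THEN iffD2], intro exI[of _ UNIV] conjI ballI impI)
      fix t :: real assume "t \<noteq> 0"
      then have "inverse t *\<^sub>R (c t - c 0) - d = inverse t *\<^sub>R (c t - c 0 - t *\<^sub>R d)"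
        by (simp add: algebra_simps)
      then show "norm (c t - c 0 - t *\<^sub>R d) / \<bar>t\<bar> = norm (inverse t *\<^sub>R (c t - c 0) - d)"
        by (simp add: divide_inverse)
    qed auto
    ultimately have "((\<lambda>t. norm (inverse t *\<^sub>R (c t - c 0) - d)) \<longlongrightarrow> 0) (at 0)"
      by (rule Lim_transform_eventually)
    then show ?thesis
      using tendsto_norm_zero_iff LIM_zero_iff by blast
  qed
  have "\<forall>\<^sub>F t in at 0. inverse t *\<^sub>R (c t - c 0) \<in> W"
    unfolding eventually_at
    using assms(1,2) c0 W
    by (intro exI[of _ \<epsilon>]) (auto intro!: subspace_scale subspace_diff simp: dist_real_def abs_less_iff)
  then show ?thesis
    using Lim_in_closed_set[OF closed_subspace[OF W] _ _ lim] by simp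
qed

text \<open>Velocities of curves are hard to add; as the preimage of \<open>W\<close> under a linear
  map they visibly form a subspace. Coordinate lines realise all of the preimage.\<close>

lemma tangent_space_eq:
  assumes "q \<in> S" "q \<in> U"
  shows "tangent_space S q = {v. D\<phi> q v \<in> W}"
proof (intro set_eqI iffI; clarsimp)
  fix v assume "v \<in> tangent_space S q"
  then obtain \<gamma> \<epsilon> where \<gamma>: "\<epsilon> > 0" "smooth_on {-\<epsilon><..<\<epsilon>} \<gamma>" "\<gamma> 0 = q" 
    "\<And>t. t \<in> {-\<epsilon><..<\<epsilon>} \<Longrightarrow> \<gamma> t \<in> S" "(\<gamma> has_vector_derivative v) (at (0::real))"
    unfolding tangent_space_def by blast
  have "isCont \<gamma> 0" using \<gamma>(5) has_vector_derivative_continuous by blast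
  then have "\<forall>\<^sub>F t in at 0. \<gamma> t \<in> U"
    using open_U assms(2) \<gamma>(3) unfolding isCont_def by (metis topological_tendstoD)
  then obtain d where "d > 0" "\<forall>t. t \<noteq> 0 \<and> \<bar>t\<bar> < d \<longrightarrow> \<gamma> t \<in> U"
    unfolding eventually_at by (auto simp: dist_real_def)
  then have d: "d > 0" "\<And>t. \<bar>t\<bar> < d \<Longrightarrow> \<gamma> t \<in> U" using assms(2) \<gamma>(3) by metis+
  have "((\<lambda>t. \<phi> (\<gamma> t)) has_vector_derivative D\<phi> q v) (at 0)"
    using has_derivative_compose[OF \<gamma>(5)[unfolded has_vector_derivative_def], of \<phi> "D\<phi> q"] D\<phi>[OF assms(2)]
      linear_D\<phi>[OF assms(2)] \<gamma>(3) by (simp add: has_vector_derivative_def linear_scale)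
  then show "D\<phi> q v \<in> W"
    by (rule curve_derivative_slice[rotated 2, where \<epsilon>="min d \<epsilon>"]) (use d \<gamma> \<phi>_slice in auto)
next
  fix v assume v: "D\<phi> q v \<in> W"
  let ?w = "D\<phi> q v"
  obtain \<epsilon> where \<epsilon>: "\<epsilon> > 0" "\<And>t. t \<in> {-\<epsilon><..<\<epsilon>} \<Longrightarrow> \<phi> q + t *\<^sub>R ?w \<in> V"
    "\<And>t. t \<in> {-\<epsilon><..<\<epsilon>} \<Longrightarrow> \<psi> (\<phi> q + t *\<^sub>R ?w) \<in> S"
    using coordinate_line[OF assms v] by blast
  have "smooth_on {-\<epsilon><..<\<epsilon>} (\<lambda>t. \<psi> (\<phi> q + t *\<^sub>R ?w))"
    by (rule smooth_on_compose[OF _ open_V \<psi>])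
      (use \<epsilon> in \<open>auto intro!: smooth_on_add smooth_on_scaleR smooth_on_const smooth_on_ident\<close>)
  moreover have "((\<lambda>t. \<psi> (\<phi> q + t *\<^sub>R ?w)) has_vector_derivative v) (at 0)"
    using coordinate_line_derivative[of q 0 ?w] assms \<phi>_in D\<psi>_D\<phi> by simp
  ultimately show "v \<in> tangent_space S q"
    unfolding tangent_space_def using \<epsilon> assms \<psi>\<phi>
    by (intro CollectI exI[of _ "\<lambda>t. \<psi> (\<phi> q + t *\<^sub>R ?w)"] exI[of _ \<epsilon>]) auto
qed

lemma tangent_space_image: "q \<in> S \<Longrightarrow> q \<in> U \<Longrightarrow> tangent_space S q = D\<psi> (\<phi> q) ` W"
  unfolding tangent_space_eq using D\<phi>_D\<psi> D\<psi>_D\<phi> by (auto simp: image_iff) (metis)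

lemma subspace_tangent_space: "q \<in> S \<Longrightarrow> q \<in> U \<Longrightarrow> subspace (tangent_space S q)"
  using tangent_space_image linear_subspace_image linear_D\<psi> \<phi>_in W by metis

lemma dim_tangent_space: 
  assumes "q \<in> S" "q \<in> U" shows "dim (tangent_space S q) = dim W"
proof -
  have "inj_on (D\<psi> (\<phi> q)) (span W)"
    by (rule inj_on_inverseI[where g="D\<phi> q"]) (use assms D\<phi>_D\<psi> in auto)
  then show ?thesis
    using tangent_space_image[OF assms] eucl.dim_image_eq[OF linear_D\<psi>[OF \<phi>_in[OF assms(2)]]] by metis
qed

text \<open>In the chart, a tangent field is a curve in \<open>W\<close> along each curve in the slice; its derivative
  stays in \<open>W\<close>, which computes the normal part of the derivative from the value of the field alone.\<close>

lemma tangent_field_derivative: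
  assumes "q \<in> S" "q \<in> U" and u: "u \<in> tangent_space S q"
    and X: "open U1" "q \<in> U1" "smooth_on U1 X" "\<And>x. x \<in> S \<inter> U1 \<Longrightarrow> X x \<in> tangent_space S x"
  shows "D\<phi> q (frechet_derivative X (at q) u) + frechet_derivative (\<lambda>x. D\<phi> x (X q)) (at q) u \<in> W"
proof -
  let ?w = "D\<phi> q u"
  define c where "c = (\<lambda>t. \<psi> (\<phi> q + t *\<^sub>R ?w))"
  have wW: "?w \<in> W" using u assms tangent_space_eq by auto
  obtain \<epsilon> where \<epsilon>: "\<epsilon> > 0" "\<And>t. t \<in> {-\<epsilon><..<\<epsilon>} \<Longrightarrow> \<phi> q + t *\<^sub>R ?w \<in> V"
    "\<And>t. t \<in> {-\<epsilon><..<\<epsilon>} \<Longrightarrow> c t \<in> S"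
    using coordinate_line[OF assms(1,2) wW] unfolding c_def by blast
  have c0: "c 0 = q" using assms \<psi>\<phi> by (simp add: c_def)
  have dc: "(c has_vector_derivative u) (at 0)"
    using coordinate_line_derivative[of q 0 ?w] assms \<phi>_in D\<psi>_D\<phi> by (simp add: c_def)
  have cU: "c t \<in> U" if "t \<in> {-\<epsilon><..<\<epsilon>}" for t using \<epsilon>(2)[OF that] \<psi>_in by (simp add: c_def)
  have "isCont c 0" using dc has_vector_derivative_continuous by blast
  then have "\<forall>\<^sub>F t in at 0. c t \<in> U1"
    using X(1,2) c0 unfolding isCont_def by (metis topological_tendstoD)
  then obtain d where "d > 0" "\<forall>t. t \<noteq> 0 \<and> \<bar>t\<bar> < d \<longrightarrow> c t \<in> U1"
    unfolding eventually_at by (auto simp: dist_real_def)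
  then have d: "d > 0" "\<And>t. \<bar>t\<bar> < d \<Longrightarrow> c t \<in> U1" using X(2) c0 by metis+
  have dX: "((\<lambda>t. X (c t)) has_vector_derivative frechet_derivative X (at q) u) (at 0)"
    using has_derivative_compose[OF dc[unfolded has_vector_derivative_def], of X "frechet_derivative X (at q)"]
      smooth_on_has_derivative[OF X(3,2)] has_derivative_linear[OF smooth_on_has_derivative[OF X(3,2)]] c0
    by (simp add: has_vector_derivative_def linear_scale)
  \<comment> \<open>Expanding \<open>X\<close> in a basis turns \<open>D\<phi> (c t) (X (c t))\<close> into a finite sum of products.\<close>
  have "((\<lambda>t. \<Sum>b\<in>Basis. (X (c t) \<bullet> b) *\<^sub>R D\<phi> (c t) b) has_vector_derivative
     (\<Sum>b\<in>Basis. (X q \<bullet> b) *\<^sub>R frechet_derivative (\<lambda>x. D\<phi> x b) (at q) u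
        + (frechet_derivative X (at q) u \<bullet> b) *\<^sub>R D\<phi> q b)) (at 0)"
  proof (rule has_vector_derivative_sum)
    fix b :: 'a
    have "((\<lambda>t. X (c t) \<bullet> b) has_real_derivative frechet_derivative X (at q) u \<bullet> b) (at 0)"
      using has_derivative_inner_left[OF dX[unfolded has_vector_derivative_def], of b]
      by (simp add: has_field_derivative_def mult_commute_abs)
    moreover have "((\<lambda>t. D\<phi> (c t) b) has_vector_derivative frechet_derivative (\<lambda>x. D\<phi> x b) (at q) u) (at 0)"
      using has_derivative_compose[OF dc[unfolded has_vector_derivative_def], of "\<lambda>x. D\<phi> x b" "frechet_derivative (\<lambda>x. D\<phi> x b) (at q)"]
        smooth_on_has_derivative[OF smooth_on_derivative[OF \<phi>] assms(2)]
        has_derivative_linear[OF smooth_on_has_derivative[OF smooth_on_derivative[OF \<phi>, of b] assms(2)]] c0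
      by (simp add: has_vector_derivative_def linear_scale)
    ultimately show "((\<lambda>t. (X (c t) \<bullet> b) *\<^sub>R D\<phi> (c t) b) has_vector_derivative
        (X q \<bullet> b) *\<^sub>R frechet_derivative (\<lambda>x. D\<phi> x b) (at q) u
        + (frechet_derivative X (at q) u \<bullet> b) *\<^sub>R D\<phi> q b) (at 0)"
      using has_vector_derivative_scaleR c0 by fastforce
  qed
  then have "(\<Sum>b\<in>Basis. (X q \<bullet> b) *\<^sub>R frechet_derivative (\<lambda>x. D\<phi> x b) (at q) u
        + (frechet_derivative X (at q) u \<bullet> b) *\<^sub>R D\<phi> q b) \<in> W"
  proof (rule curve_derivative_slice[rotated 2, where \<epsilon>="min d \<epsilon>"])
    fix t assume t: "t \<in> {- min d \<epsilon><..<min d \<epsilon>}"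
    then have "c t \<in> U" "c t \<in> U1" "c t \<in> S" using cU d \<epsilon> by auto
    then have "D\<phi> (c t) (X (c t)) \<in> W" using X(4)[of "c t"] tangent_space_eq by auto
    then show "(\<Sum>b\<in>Basis. (X (c t) \<bullet> b) *\<^sub>R D\<phi> (c t) b) \<in> W"
      by (simp add: linear_basis_expansion[OF linear_D\<phi>[OF \<open>c t \<in> U\<close>]])
  qed (use d \<epsilon> in auto)
  moreover have "(\<Sum>b\<in>Basis. (frechet_derivative X (at q) u \<bullet> b) *\<^sub>R D\<phi> q b) = D\<phi> q (frechet_derivative X (at q) u)"
    by (rule linear_basis_expansion[OF linear_D\<phi>[OF assms(2)]])
  moreover have "(\<Sum>b\<in>Basis. (X q \<bullet> b) *\<^sub>R frechet_derivative (\<lambda>x. D\<phi> x b) (at q) u)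
      = frechet_derivative (\<lambda>x. D\<phi> x (X q)) (at q) u"
  proof -
    have "((\<lambda>x. \<Sum>b\<in>Basis. (X q \<bullet> b) *\<^sub>R D\<phi> x b) has_derivative
        (\<lambda>u. \<Sum>b\<in>Basis. (X q \<bullet> b) *\<^sub>R frechet_derivative (\<lambda>x. D\<phi> x b) (at q) u)) (at q)"
      by (intro has_derivative_sum has_derivative_scaleR_right
          smooth_on_has_derivative[OF smooth_on_derivative[OF \<phi>] assms(2)])
    then have "((\<lambda>x. D\<phi> x (X q)) has_derivative
        (\<lambda>u. \<Sum>b\<in>Basis. (X q \<bullet> b) *\<^sub>R frechet_derivative (\<lambda>x. D\<phi> x b) (at q) u)) (at q)"
    proof (rule has_derivative_transform_within_open[OF _ open_U assms(2)])
      fix x assume "x \<in> U"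
      then show "(\<Sum>b\<in>Basis. (X q \<bullet> b) *\<^sub>R D\<phi> x b) = D\<phi> x (X q)"
        by (rule linear_basis_expansion[OF linear_D\<phi>])
    qed
    from fun_cong[OF frechet_derivative_at[OF this], of u] show ?thesis .
  qed
  ultimately show ?thesis by (simp add: sum.distrib add.commute)
qed

text \<open>The field with constant chart coordinates is a tangent extension of \<open>v\<close>, as
  the second fundamental form asks for.\<close>

lemma coordinate_field:
  assumes "q \<in> S" "q \<in> U" "v \<in> tangent_space S q"
  defines "X \<equiv> \<lambda>x. D\<psi> (\<phi> x) (D\<phi> q v)"
  shows "smooth_on U X" "X q = v" "\<And>x. x \<in> S \<inter> U \<Longrightarrow> X x \<in> tangent_space S x"
proof -
  show "smooth_on U X"
    unfolding X_def
    by (rule smooth_on_compose[OF open_U open_V smooth_on_derivative[OF \<psi>] \<phi>]) (use \<phi>_in in auto)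
  show "X q = v" using assms D\<psi>_D\<phi> by (simp add: X_def)
  show "X x \<in> tangent_space S x" if "x \<in> S \<inter> U" for x
    using that assms tangent_space_eq D\<phi>_D\<psi> by (auto simp: X_def)
qed

end

lemma smooth_submanifold_chart:
  fixes S :: "'a::euclidean_space set"
  assumes "smooth_submanifold k S" "p \<in> S"
  obtains U V W \<phi> \<psi> where "slice_chart S U V W \<phi> \<psi>" "p \<in> U" "dim W = k"
proof -
  from bspec[OF assms(1)[unfolded smooth_submanifold_def] assms(2)] show thesis
  proof (elim exE conjE)
    fix U V W :: "'a set" and \<phi>
    assume *: "open U" "p \<in> U" "open V" "diffeomorphism_betw U V \<phi>"
      "subspace W" "dim W = k" "\<phi> ` (S \<inter> U) = W \<inter> V"
    then have bij: "bij_betw \<phi> U V" and sm: "smooth_map_on U \<phi>" "smooth_map_on V (inv_into U \<phi>)"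
      by (auto simp: diffeomorphism_betw_def)
    have "slice_chart S U V W \<phi> (inv_into U \<phi>)"
      by unfold_locales
        (use * bij smooth_map_on_open[OF *(1) sm(1)] smooth_map_on_open[OF *(3) sm(2)]
          in \<open>auto simp: bij_betw_def inv_into_into f_inv_into_f\<close>)
    with that * show thesis by blast
  qed
qed

section \<open>The maximum principle on minimal submanifolds of hyperbolic space\<close>

lemma inner_self_lt_1: "norm x < 1 \<Longrightarrow> x \<bullet> x < 1" for x :: "'a::real_inner"
  by (simp add: norm_lt square_norm_one power2_norm_eq_inner[symmetric] abs_square_less_1)

lemma second_derivative_at_max:
  fixes j j' :: "real \<Rightarrow> real"
  assumes "\<epsilon> > 0" and j: "\<And>t. \<bar>t\<bar> < \<epsilon> \<Longrightarrow> (j has_real_derivative j' t) (at t)"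
    and j': "(j' has_real_derivative d) (at 0)"
    and max: "\<And>t. \<bar>t\<bar> < \<epsilon> \<Longrightarrow> j t \<le> j 0"
  shows "j' 0 = 0" "d \<le> 0"
proof -
  show z: "j' 0 = 0"
    using DERIV_local_max[OF j[of 0] assms(1)] assms(1) max by auto
  show "d \<le> 0"
  proof (rule ccontr)
    assume "\<not> d \<le> 0"
    then obtain \<delta> where \<delta>: "\<delta> > 0" "\<And>h. 0 < h \<Longrightarrow> h < \<delta> \<Longrightarrow> 0 < j' h"
      using DERIV_pos_inc_right[OF j'] z by auto
    define h where "h = min \<delta> \<epsilon> / 2"
    have h: "0 < h" "h < \<delta>" "h < \<epsilon>" using \<delta>(1) assms(1) by (auto simp: h_def)
    have "j 0 < j h"
    proof (rule DERIV_pos_imp_increasing_open[OF h(1)])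
      show "continuous_on {0..h} j"
        using h by (intro continuous_at_imp_continuous_on ballI DERIV_isCont[OF j]) auto
      show "\<exists>y. (j has_real_derivative y) (at x) \<and> 0 < y" if "0 < x" "x < h" for x
        using j[of x] \<delta>(2)[of x] that h by auto
    qed
    then show False using max[of h] h by auto
  qed
qed

section \<open>The connection and the normal part for the hyperbolic metric\<close>

lemma hyperbolic_metric_has_derivative:
  assumes "norm p < 1"
  shows "((\<lambda>x. hyperbolic_metric x a b) has_derivative
     (\<lambda>u. (2 / (1 - p \<bullet> p))\<^sup>2 * (4 / (1 - p \<bullet> p)) * (p \<bullet> u) * (a \<bullet> b))) (at p)"
proof -
  have "p \<bullet> p < 1" using assms by (simp add: inner_self_lt_1)
  then have nz: "1 - p \<bullet> p \<noteq> 0" by simp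
  have "((\<lambda>x. (4 * (a \<bullet> b)) * (inverse (1 - x \<bullet> x))\<^sup>2) has_derivative
     (\<lambda>u. (2 / (1 - p \<bullet> p))\<^sup>2 * (4 / (1 - p \<bullet> p)) * (p \<bullet> u) * (a \<bullet> b))) (at p)"
    using nz by (auto intro!: derivative_eq_intros ext simp: power2_eq_square divide_inverse inner_commute algebra_simps)
  moreover have "(\<lambda>x. hyperbolic_metric x a b) = (\<lambda>x. (4 * (a \<bullet> b)) * (inverse (1 - x \<bullet> x))\<^sup>2)"
    by (auto simp: hyperbolic_metric_def power2_norm_eq_inner power_divide power_inverse divide_inverse)
  ultimately show ?thesis by simp
qed

text \<open>The conformal change formula: the metric is the square of
  \<open>2 / (1 - norm p ^ 2)\<close> times the Euclidean one, and the logarithm of this factor has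
  gradient \<open>2 / (1 - norm p ^ 2)\<close> times \<open>p\<close>. Nondegeneracy makes the
  definite description unique.\<close>

lemma christoffel_hyperbolic_metric:
  assumes "norm p < 1"
  shows "christoffel hyperbolic_metric p u v =
    (2 / (1 - p \<bullet> p)) *\<^sub>R ((p \<bullet> u) *\<^sub>R v + (p \<bullet> v) *\<^sub>R u - (u \<bullet> v) *\<^sub>R p)"
proof -
  let ?w = "(2 / (1 - p \<bullet> p)) *\<^sub>R ((p \<bullet> u) *\<^sub>R v + (p \<bullet> v) *\<^sub>R u - (u \<bullet> v) *\<^sub>R p)"
  have "p \<bullet> p < 1" using assms by (simp add: inner_self_lt_1)
  then have pos: "(2 / (1 - p \<bullet> p))\<^sup>2 > 0" by simp
  have D: "frechet_derivative (\<lambda>x. hyperbolic_metric x a b) (at p) =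
     (\<lambda>u. (2 / (1 - p \<bullet> p))\<^sup>2 * (4 / (1 - p \<bullet> p)) * (p \<bullet> u) * (a \<bullet> b))" for a b
    using frechet_derivative_at[OF hyperbolic_metric_has_derivative[OF assms]] by metis
  have eq: "2 * hyperbolic_metric p w z = (2 / (1 - p \<bullet> p))\<^sup>2 * (2 * (w \<bullet> z))" for w z
    by (simp add: hyperbolic_metric_def power2_norm_eq_inner)
  have rhs: "frechet_derivative (\<lambda>x. hyperbolic_metric x v z) (at p) u
     + frechet_derivative (\<lambda>x. hyperbolic_metric x u z) (at p) v
     - frechet_derivative (\<lambda>x. hyperbolic_metric x u v) (at p) z = (2 / (1 - p \<bullet> p))\<^sup>2 * (2 * (?w \<bullet> z))" for z
    unfolding D by (simp add: inner_add_left inner_diff_left algebra_simps)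
  show ?thesis
    unfolding christoffel_def
  proof (rule the_equality)
    fix w
    assume "\<forall>z. 2 * hyperbolic_metric p w z = frechet_derivative (\<lambda>x. hyperbolic_metric x v z) (at p) u
     + frechet_derivative (\<lambda>x. hyperbolic_metric x u z) (at p) v
     - frechet_derivative (\<lambda>x. hyperbolic_metric x u v) (at p) z"
    then have "(2 / (1 - p \<bullet> p))\<^sup>2 * (2 * (w \<bullet> z)) = (2 / (1 - p \<bullet> p))\<^sup>2 * (2 * (?w \<bullet> z))" for z
      unfolding rhs eq by blast
    then have "2 * (w \<bullet> z) = 2 * (?w \<bullet> z)" for z
      unfolding mult_left_cancel[OF less_imp_neq[OF pos, symmetric]] .
    then have "w \<bullet> z = ?w \<bullet> z" for z
      unfolding mult_left_cancel[OF zero_neq_numeral[symmetric]] .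
    then show "w = ?w" using vector_eq_rdot[of w ?w] by blast
  qed (simp only: rhs eq, simp)
qed

lemma normal_component_hyperbolic:
  assumes T: "subspace (tangent_space S p)" and "norm p < 1"
  shows "w - normal_component hyperbolic_metric S p w \<in> tangent_space S p"
proof -
  let ?T = "tangent_space S p"
  have "p \<bullet> p < 1" using assms by (simp add: inner_self_lt_1)
  then have g0: "hyperbolic_metric p z t = 0 \<longleftrightarrow> z \<bullet> t = 0" for z t
    by (simp add: hyperbolic_metric_def power2_norm_eq_inner)
  have "\<exists>!z. w - z \<in> ?T \<and> (\<forall>t\<in>?T. hyperbolic_metric p z t = 0)"
  proof -
    have span: "span ?T = ?T" using T by (simp add: span_eq_iff)
    obtain y z where yz: "y \<in> ?T" "\<And>t. t \<in> ?T \<Longrightarrow> orthogonal z t" "w = y + z"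
      using orthogonal_subspace_decomp_exists[of ?T w] unfolding span by metis
    show ?thesis
    proof (rule ex1I[of _ z])
      show "w - z \<in> ?T \<and> (\<forall>t\<in>?T. hyperbolic_metric p z t = 0)"
        using yz by (auto simp: g0 orthogonal_def)
    next
      fix z' assume z': "w - z' \<in> ?T \<and> (\<forall>t\<in>?T. hyperbolic_metric p z' t = 0)"
      have "(w - z) - (w - z') \<in> ?T"
        by (rule subspace_diff[OF T]) (use yz z' in auto)
      then have "z' - z \<in> ?T" by simp
      then have "(z' - z) \<bullet> (z' - z) = 0"
        using z' yz by (metis g0 inner_diff_left orthogonal_def diff_self)
      then show "z' = z" by simp
    qed
  qed
  from theI'[OF this] show ?thesis by (simp add: normal_component_def)
qed

lemma normal_component_cong:
  assumes "subspace (tangent_space S p)" and "w' - w \<in> tangent_space S p"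
  shows "normal_component g S p w = normal_component g S p w'"
proof -
  have "w - z \<in> tangent_space S p \<longleftrightarrow> w' - z \<in> tangent_space S p" for z
  proof
    assume "w - z \<in> tangent_space S p"
    from subspace_add[OF assms(1) this assms(2)] show "w' - z \<in> tangent_space S p" by simp
  next
    assume "w' - z \<in> tangent_space S p"
    from subspace_diff[OF assms(1) this assms(2)] show "w - z \<in> tangent_space S p" by simp
  qed
  then show ?thesis by (simp add: normal_component_def)
qed

lemma hyperbolic_orthonormal_basis_exists:
  assumes T: "subspace T" and "norm p < 1"
  shows "\<exists>B. orthonormal_basis hyperbolic_metric p T B"
proof -
  have "p \<bullet> p < 1" using assms by (simp add: inner_self_lt_1)
  then have s: "1 - p \<bullet> p > 0" by simp
  define a where "a = (1 - p \<bullet> p) / 2"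
  have a: "a > 0" using s by (simp add: a_def)
  obtain B where B: "B \<subseteq> T" "pairwise orthogonal B" "\<And>x. x \<in> B \<Longrightarrow> norm x = 1" "independent B" "span B = T"
    using orthonormal_basis_subspace[OF T] by metis
  have "finite B" using B(4) independent_imp_finite by blast
  have "orthonormal_basis hyperbolic_metric p T ((\<lambda>b. a *\<^sub>R b) ` B)"
    unfolding orthonormal_basis_def
  proof (intro conjI ballI)
    show "independent ((\<lambda>b. a *\<^sub>R b) ` B)"
      using a by (intro linear_independent_injective_image B(4)) (auto intro: linear_scale_self inj_onI)
    show "span ((\<lambda>b. a *\<^sub>R b) ` B) = T"
      using span_image_scale[OF \<open>finite B\<close>, of "\<lambda>_. a"] a B(5) by simp
    fix b c assume "b \<in> (\<lambda>b. a *\<^sub>R b) ` B" "c \<in> (\<lambda>b. a *\<^sub>R b) ` B"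
    then obtain x y where xy: "x \<in> B" "y \<in> B" "b = a *\<^sub>R x" "c = a *\<^sub>R y" by auto
    have "x \<bullet> y = (if x = y then 1 else 0)"
      using B(2,3) xy by (auto simp: pairwise_def orthogonal_def norm_eq_1)
    moreover have "hyperbolic_metric p b c = (2 / (1 - p \<bullet> p))\<^sup>2 * (b \<bullet> c)"
      by (simp add: hyperbolic_metric_def power2_norm_eq_inner)
    then have "hyperbolic_metric p b c = x \<bullet> y"
      using s by (simp add: xy a_def power2_eq_square)
    ultimately show "hyperbolic_metric p b c = (if b = c then 1 else 0)"
      using xy a by simp
  qed
  then show ?thesis ..
qed

context slice_chart
begin

text \<open>By \<open>tangent_field_derivative\<close> two tangent extensions of \<open>v\<close>
  have derivatives along \<open>u\<close> that differ by a tangent vector, and their Christoffel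
  terms agree, so the normal parts coincide and the definite description is legitimate.\<close>

lemma second_fundamental_form_eq:
  assumes q: "q \<in> S" "q \<in> U" "norm q < 1" and uv: "u \<in> tangent_space S q" "v \<in> tangent_space S q"
    and X: "open U1" "q \<in> U1" "smooth_on U1 X" "\<forall>x\<in>S \<inter> U1. X x \<in> tangent_space S x" "X q = v"
  shows "second_fundamental_form hyperbolic_metric S q u v =
    normal_component hyperbolic_metric S q (covariant_derivative hyperbolic_metric X q u)"
  unfolding second_fundamental_form_def
proof (rule the_equality)
  fix w
  assume "\<exists>U X. open U \<and> q \<in> U \<and> smooth_on U X \<and> (\<forall>x\<in>S \<inter> U. X x \<in> tangent_space S x) \<and>
     X q = v \<and> w = normal_component hyperbolic_metric S q (covariant_derivative hyperbolic_metric X q u)"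
  then obtain U2 Y where Y: "open U2" "q \<in> U2" "smooth_on U2 Y" "\<forall>x\<in>S \<inter> U2. Y x \<in> tangent_space S x"
     "Y q = v" "w = normal_component hyperbolic_metric S q (covariant_derivative hyperbolic_metric Y q u)"
    by blast
  let ?r = "frechet_derivative (\<lambda>x. D\<phi> x v) (at q) u"
  have "(D\<phi> q (frechet_derivative X (at q) u) + ?r) - (D\<phi> q (frechet_derivative Y (at q) u) + ?r) \<in> W"
    using tangent_field_derivative[OF q(1,2) uv(1) X(1-3)] tangent_field_derivative[OF q(1,2) uv(1) Y(1-3)]
      X Y W by (intro subspace_diff) auto
  then have "D\<phi> q (frechet_derivative X (at q) u - frechet_derivative Y (at q) u) \<in> W"
    using linear_D\<phi>[OF q(2)] by (simp add: linear_diff)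
  then have "covariant_derivative hyperbolic_metric X q u - covariant_derivative hyperbolic_metric Y q u
      \<in> tangent_space S q"
    using tangent_space_eq[OF q(1,2)] X Y by (simp add: covariant_derivative_def)
  then show "w = normal_component hyperbolic_metric S q (covariant_derivative hyperbolic_metric X q u)"
    using normal_component_cong subspace_tangent_space q Y(6) by blast
qed (use X in blast)

text \<open>A coordinate line is an integral curve of its coordinate field \<open>X\<close>. Hence
  the first derivative of \<open>F\<close> along it is \<open>grad \<bullet> X\<close>, and
  differentiating once more at the maximum gives the two terms of the conclusion.\<close>

lemma second_derivative_at_max_on_submanifold:
  assumes q: "q \<in> S" "q \<in> U" and e: "e \<in> tangent_space S q"
    and F: "\<And>x. (F has_derivative (\<lambda>v. grad x \<bullet> v)) (at x)" "(grad has_derivative H) (at q)"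
      "\<And>x. x \<in> S \<Longrightarrow> F x \<le> F q"
  obtains X where "smooth_on U X" "\<forall>x\<in>S \<inter> U. X x \<in> tangent_space S x" "X q = e" "grad q \<bullet> e = 0"
    "H e \<bullet> e + grad q \<bullet> frechet_derivative X (at q) e \<le> 0"
proof -
  let ?w = "D\<phi> q e"
  define X where "X = (\<lambda>x. D\<psi> (\<phi> x) ?w)"
  have X: "smooth_on U X" "X q = e" "\<And>x. x \<in> S \<inter> U \<Longrightarrow> X x \<in> tangent_space S x"
    using coordinate_field[OF q e] by (auto simp: X_def)
  define c where "c = (\<lambda>t. \<psi> (\<phi> q + t *\<^sub>R ?w))"
  have wW: "?w \<in> W" using e q tangent_space_eq by auto
  obtain \<epsilon> where \<epsilon>: "\<epsilon> > 0" "\<And>t. t \<in> {-\<epsilon><..<\<epsilon>} \<Longrightarrow> \<phi> q + t *\<^sub>R ?w \<in> V"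
    "\<And>t. t \<in> {-\<epsilon><..<\<epsilon>} \<Longrightarrow> c t \<in> S"
    using coordinate_line[OF q wW] unfolding c_def by blast
  have c0: "c 0 = q" using q \<psi>\<phi> by (simp add: c_def)
  have dc: "(c has_derivative (\<lambda>s. s *\<^sub>R X (c t))) (at t)" if "\<bar>t\<bar> < \<epsilon>" for t
  proof -
    have "\<phi> q + t *\<^sub>R ?w \<in> V" by (rule \<epsilon>(2)) (use that in auto)
    from coordinate_line_derivative[OF this] \<phi>\<psi>[OF this] show ?thesis
      by (simp add: X_def c_def has_vector_derivative_def)
  qed
  have dc0: "(c has_derivative (\<lambda>s. s *\<^sub>R e)) (at 0)" using dc[of 0] \<epsilon>(1) c0 X(2) by simp
  have dj: "((\<lambda>t. F (c t)) has_real_derivative grad (c t) \<bullet> X (c t)) (at t)" if "\<bar>t\<bar> < \<epsilon>" for t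
    using has_derivative_compose[OF dc[OF that] F(1)] by (simp add: has_field_derivative_def mult_commute_abs)
  have "((\<lambda>t. grad (c t)) has_derivative (\<lambda>s. s *\<^sub>R H e)) (at 0)"
    using has_derivative_compose[OF dc0, of grad H] F(2) c0 has_derivative_linear[OF F(2)]
    by (simp add: linear_scale)
  moreover have "((\<lambda>t. X (c t)) has_derivative (\<lambda>s. s *\<^sub>R frechet_derivative X (at q) e)) (at 0)"
    using has_derivative_compose[OF dc0, of X "frechet_derivative X (at q)"] c0
      smooth_on_has_derivative[OF X(1) q(2)] has_derivative_linear[OF smooth_on_has_derivative[OF X(1) q(2)]]
    by (simp add: linear_scale)
  ultimately have "((\<lambda>t. grad (c t) \<bullet> X (c t)) has_derivative
     (\<lambda>s. grad (c 0) \<bullet> (s *\<^sub>R frechet_derivative X (at q) e) + (s *\<^sub>R H e) \<bullet> X (c 0))) (at 0)"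
    by (rule has_derivative_inner)
  then have dj': "((\<lambda>t. grad (c t) \<bullet> X (c t)) has_real_derivative
      (H e \<bullet> e + grad q \<bullet> frechet_derivative X (at q) e)) (at 0)"
    unfolding has_field_derivative_def
    by (rule has_derivative_eq_rhs) (auto simp: c0 X(2) algebra_simps)
  have max: "F (c t) \<le> F (c 0)" if "\<bar>t\<bar> < \<epsilon>" for t
    using F(3)[OF \<epsilon>(3)[of t]] that by (simp add: c0 abs_less_iff)
  have "grad q \<bullet> e = 0" "H e \<bullet> e + grad q \<bullet> frechet_derivative X (at q) e \<le> 0"
    using second_derivative_at_max[OF \<epsilon>(1) dj dj' max] c0 X(2) by auto
  with that X show thesis by blast
qed

end

text \<open>The last sum is a positive multiple of the trace of the hyperbolic Hessian of
  \<open>F\<close> over the tangent space, its Christoffel part simplified by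
  \<open>grad p \<bullet> b = 0\<close>. Minimality removes the derivatives of the extending
  fields.\<close>

lemma minimal_submanifold_trace_le:
  fixes F :: "'a::euclidean_space \<Rightarrow> real"
  assumes M: "smooth_submanifold k M" "minimal hyperbolic_metric M" and "k > 0"
    and p: "p \<in> M" "norm p < 1"
    and F: "\<And>x. (F has_derivative (\<lambda>v. grad x \<bullet> v)) (at x)" "(grad has_derivative H) (at p)"
      "\<And>x. x \<in> M \<Longrightarrow> F x \<le> F p"
  obtains B where "finite B" "card B = k" "\<And>b c. b \<in> B \<Longrightarrow> c \<in> B \<Longrightarrow> b \<bullet> c = (if b = c then 1 else 0)"
    "\<And>b. b \<in> B \<Longrightarrow> grad p \<bullet> b = 0"
    "(\<Sum>b\<in>B. H b \<bullet> b + 2 / (1 - p \<bullet> p) * (grad p \<bullet> p)) \<le> 0"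
proof -
  obtain U V W \<phi> \<psi> where chart: "slice_chart M U V W \<phi> \<psi>" and pU: "p \<in> U" and dimW: "dim W = k"
    using smooth_submanifold_chart[OF M(1) p(1)] by blast
  interpret slice_chart M U V W \<phi> \<psi> by (rule chart)
  let ?T = "tangent_space M p"
  have T: "subspace ?T" and dimT: "dim ?T = k"
    using subspace_tangent_space dim_tangent_space p pU dimW by auto
  have "p \<bullet> p < 1" using p by (simp add: inner_self_lt_1)
  then have s: "1 - p \<bullet> p > 0" by simp
  define a where "a = 2 / (1 - p \<bullet> p)"
  have a: "a > 0" using s by (simp add: a_def)
  define B where "B = (SOME B. orthonormal_basis hyperbolic_metric p ?T B)"
  have "orthonormal_basis hyperbolic_metric p ?T B"
    unfolding B_def using hyperbolic_orthonormal_basis_exists[OF T p(2)] by (rule someI_ex)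
  then have B: "independent B" "span B = ?T" 
    and Bg: "\<And>b c. b \<in> B \<Longrightarrow> c \<in> B \<Longrightarrow> hyperbolic_metric p b c = (if b = c then 1 else 0)"
    by (auto simp: orthonormal_basis_def)
  have Bip: "a\<^sup>2 * (b \<bullet> c) = (if b = c then 1 else 0)" if "b \<in> B" "c \<in> B" for b c
    using Bg[OF that] by (simp add: hyperbolic_metric_def power2_norm_eq_inner a_def)
  have finB: "finite B" using B(1) independent_imp_finite by blast
  have cardB: "card B = k" using B dimT by (metis dim_span dim_eq_card_independent)
  have BT: "b \<in> ?T" if "b \<in> B" for b using that B(2) span_base by blast
  have "\<forall>e. e \<in> ?T \<longrightarrow> (\<exists>X. smooth_on U X \<and> (\<forall>x\<in>M \<inter> U. X x \<in> tangent_space M x) \<and> X p = e \<and> grad p \<bullet> e = 0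
      \<and> H e \<bullet> e + grad p \<bullet> frechet_derivative X (at p) e \<le> 0)"
  proof (intro allI impI)
    fix e assume "e \<in> ?T"
    from second_derivative_at_max_on_submanifold[OF p(1) pU this F] obtain Y where
      "smooth_on U Y" "\<forall>x\<in>M \<inter> U. Y x \<in> tangent_space M x" "Y p = e" "grad p \<bullet> e = 0"
      "H e \<bullet> e + grad p \<bullet> frechet_derivative Y (at p) e \<le> 0" .
    then show "\<exists>X. smooth_on U X \<and> (\<forall>x\<in>M \<inter> U. X x \<in> tangent_space M x) \<and> X p = e \<and> grad p \<bullet> e = 0
      \<and> H e \<bullet> e + grad p \<bullet> frechet_derivative X (at p) e \<le> 0"
      by (intro exI[of _ Y] conjI)
  qed
  then obtain X where X0: "\<forall>e. e \<in> ?T \<longrightarrow> smooth_on U (X e) \<and> (\<forall>x\<in>M \<inter> U. X e x \<in> tangent_space M x)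
      \<and> X e p = e \<and> grad p \<bullet> e = 0 \<and> H e \<bullet> e + grad p \<bullet> frechet_derivative (X e) (at p) e \<le> 0"
    unfolding choice_iff' ..
  then have X: "\<And>e. e \<in> ?T \<Longrightarrow> smooth_on U (X e)"
    "\<And>e. e \<in> ?T \<Longrightarrow> \<forall>x\<in>M \<inter> U. X e x \<in> tangent_space M x" "\<And>e. e \<in> ?T \<Longrightarrow> X e p = e"
    "\<And>e. e \<in> ?T \<Longrightarrow> grad p \<bullet> e = 0"
    "\<And>e. e \<in> ?T \<Longrightarrow> H e \<bullet> e + grad p \<bullet> frechet_derivative (X e) (at p) e \<le> 0"
    by simp_all
  define \<omega> where "\<omega> = (\<lambda>e. covariant_derivative hyperbolic_metric (X e) p e)"
  have sff: "second_fundamental_form hyperbolic_metric M p e e = normal_component hyperbolic_metric M p (\<omega> e)"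
    if "e \<in> ?T" for e
    unfolding \<omega>_def using second_fundamental_form_eq[OF p(1) pU p(2) that that open_U pU] X that by blast
  have "mean_curvature hyperbolic_metric M p = 0" using M(2) p(1) by (simp add: minimal_def)
  \<comment> \<open>The assumption \<open>k > 0\<close> allows cancelling the factor
    \<open>1 / k\<close>, which for \<open>k = 0\<close> would be \<open>0\<close> by
    convention.\<close>
  then have sum0: "(\<Sum>e\<in>B. normal_component hyperbolic_metric M p (\<omega> e)) = 0"
    using \<open>k > 0\<close> BT sff by (simp add: mean_curvature_def dimT flip: B_def)
  \<comment> \<open>Since the normal parts sum to zero, the sum of all covariant derivatives is
    tangent, and the gradient is orthogonal to tangent vectors.\<close>
  have "(\<Sum>e\<in>B. \<omega> e - normal_component hyperbolic_metric M p (\<omega> e)) \<in> ?T"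
    by (intro subspace_sum[OF T] normal_component_hyperbolic[OF T p(2)])
  then have "(\<Sum>e\<in>B. \<omega> e) \<in> ?T" by (simp add: sum_subtractf sum0)
  then have "grad p \<bullet> (\<Sum>e\<in>B. \<omega> e) = 0" by (rule X(4))
  then have "(\<Sum>e\<in>B. grad p \<bullet> \<omega> e) = 0" by (simp add: inner_sum_right)
  moreover have "grad p \<bullet> \<omega> e = grad p \<bullet> frechet_derivative (X e) (at p) e - a * (e \<bullet> e) * (grad p \<bullet> p)"
    if "e \<in> B" for e
    using BT[OF that] X(3,4)[of e]
    by (simp add: \<omega>_def covariant_derivative_def christoffel_hyperbolic_metric[OF p(2)] a_def
        inner_add_right inner_diff_right)
  ultimately have "(\<Sum>e\<in>B. grad p \<bullet> frechet_derivative (X e) (at p) e - a * (e \<bullet> e) * (grad p \<bullet> p)) = 0"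
    by simp
  moreover have "(\<Sum>e\<in>B. H e \<bullet> e + grad p \<bullet> frechet_derivative (X e) (at p) e) \<le> 0"
    using X(5) BT by (intro sum_nonpos) auto
  ultimately have le: "(\<Sum>e\<in>B. H e \<bullet> e + a * (e \<bullet> e) * (grad p \<bullet> p)) \<le> 0"
    by (simp add: sum.distrib sum_subtractf)
  have linH: "linear H" using F(2) has_derivative_linear by blast
  have inj: "inj_on ((*\<^sub>R) a) B" using a by (auto intro: inj_onI)
  show thesis
  proof (rule that[of "(*\<^sub>R) a ` B"])
    show "finite ((*\<^sub>R) a ` B)" using finB by simp
    show "card ((*\<^sub>R) a ` B) = k" using card_image[OF inj] cardB by simp
    show "b \<bullet> c = (if b = c then 1 else 0)" if "b \<in> (*\<^sub>R) a ` B" "c \<in> (*\<^sub>R) a ` B" for b c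
    proof -
      from that obtain x y where "x \<in> B" "y \<in> B" "b = a *\<^sub>R x" "c = a *\<^sub>R y" by auto
      with Bip[of x y] a show ?thesis by (simp add: power2_eq_square mult.assoc)
    qed
    show "grad p \<bullet> b = 0" if "b \<in> (*\<^sub>R) a ` B" for b
      using that X(4) BT by auto
    have "(\<Sum>b\<in>(*\<^sub>R) a ` B. H b \<bullet> b + 2 / (1 - p \<bullet> p) * (grad p \<bullet> p))
      = (\<Sum>e\<in>B. H (a *\<^sub>R e) \<bullet> (a *\<^sub>R e) + a * (grad p \<bullet> p))"
      unfolding a_def[symmetric] by (simp add: sum.reindex[OF inj])
    also have "\<dots> = (\<Sum>e\<in>B. a\<^sup>2 * (H e \<bullet> e + a * (e \<bullet> e) * (grad p \<bullet> p)))"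
    proof (rule sum.cong)
      fix e assume "e \<in> B"
      have "a * (grad p \<bullet> p) = (a\<^sup>2 * (e \<bullet> e)) * (a * (grad p \<bullet> p))" using Bip[OF \<open>e \<in> B\<close> \<open>e \<in> B\<close>] by simp
      then show "H (a *\<^sub>R e) \<bullet> (a *\<^sub>R e) + a * (grad p \<bullet> p) = a\<^sup>2 * (H e \<bullet> e + a * (e \<bullet> e) * (grad p \<bullet> p))"
        by (simp add: linear_scale[OF linH] power2_eq_square algebra_simps)
    qed simp
    also have "\<dots> \<le> 0" using le by (simp add: sum_distrib_left[symmetric] mult_nonneg_nonpos)
    finally show "(\<Sum>b\<in>(*\<^sub>R) a ` B. H b \<bullet> b + 2 / (1 - p \<bullet> p) * (grad p \<bullet> p)) \<le> 0" .
  qed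
qed

section \<open>The barrier\<close>

lemma Bessel_inequality:
  fixes l :: "'a::real_inner"
  assumes "finite B" "\<And>b c. b \<in> B \<Longrightarrow> c \<in> B \<Longrightarrow> b \<bullet> c = (if b = c then 1 else 0)"
  shows "(\<Sum>b\<in>B. (l \<bullet> b)\<^sup>2) \<le> l \<bullet> l"
proof -
  define y where "y = (\<Sum>b\<in>B. (l \<bullet> b) *\<^sub>R b)"
  have ly: "l \<bullet> y = (\<Sum>b\<in>B. (l \<bullet> b)\<^sup>2)"
    by (simp add: y_def inner_sum_right power2_eq_square)
  have "y \<bullet> c = l \<bullet> c" if "c \<in> B" for c
  proof -
    have "y \<bullet> c = (\<Sum>b\<in>B. if b = c then l \<bullet> b else 0)"
      unfolding y_def inner_sum_left using assms(2) that by (intro sum.cong) auto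
    then show ?thesis using assms(1) that by simp
  qed
  then have "y \<bullet> y = (\<Sum>b\<in>B. (l \<bullet> b)\<^sup>2)"
    by (subst (2) y_def) (simp add: inner_sum_right power2_eq_square)
  moreover have "0 \<le> (l - y) \<bullet> (l - y)" by simp
  ultimately show ?thesis using ly by (simp add: inner_diff_left inner_diff_right inner_commute)
qed

text \<open>Up to the factor \<open>1 - norm x ^ 2\<close>, the values at \<open>x\<close> of the time coordinate and of the
  space coordinate in direction \<open>u\<close> on the hyperboloid, boosted by \<open>ch = cosh \<tau>\<close> and \<open>sh = sinh \<tau>\<close>
  along the geodesic from \<open>-u\<close> to \<open>u\<close>.\<close>

definition boosted_time :: "real \<Rightarrow> real \<Rightarrow> 'a::euclidean_space \<Rightarrow> 'a \<Rightarrow> real" where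
  "boosted_time ch sh u x = (1 + x \<bullet> x) * ch - 2 * (x \<bullet> u) * sh"

definition boosted_height :: "real \<Rightarrow> real \<Rightarrow> 'a::euclidean_space \<Rightarrow> 'a \<Rightarrow> real" where
  "boosted_height ch sh u x = 2 * (x \<bullet> u) * ch - (1 + x \<bullet> x) * sh"

text \<open>A boost preserves the Lorentz form. The right side is what the hyperboloid equation
  gives after clearing denominators; the bracket is the squared length of the part of
  \<open>x\<close> orthogonal to a unit vector \<open>u\<close>.\<close>

lemma boosted_time_height:
  assumes "ch\<^sup>2 - sh\<^sup>2 = 1"
  shows "(boosted_time ch sh u x)\<^sup>2 - (boosted_height ch sh u x)\<^sup>2
    = (1 - x \<bullet> x)\<^sup>2 + 4 * (x \<bullet> x - (x \<bullet> u)\<^sup>2)"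
proof -
  have "(boosted_time ch sh u x)\<^sup>2 - (boosted_height ch sh u x)\<^sup>2
    = (ch\<^sup>2 - sh\<^sup>2) * ((1 + x \<bullet> x)\<^sup>2 - 4 * (x \<bullet> u)\<^sup>2)"
    by (simp add: boosted_time_def boosted_height_def power2_eq_square algebra_simps)
  also have "\<dots> = (1 - x \<bullet> x)\<^sup>2 + 4 * (x \<bullet> x - (x \<bullet> u)\<^sup>2)"
    unfolding assms by (simp add: power2_eq_square algebra_simps)
  finally show ?thesis .
qed

lemma continuous_on_boosted [continuous_intros]:
  "continuous_on A (boosted_time ch sh u)" "continuous_on A (boosted_height ch sh u)"
  unfolding boosted_time_def boosted_height_def by (intro continuous_intros)+

text \<open>\<open>D\<close> will be the maximal value of \<open>X0 ^ 2 - c * Z ^ 2\<close>.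
  Multiplying the difference from \<open>D\<close> by \<open>(1 - norm x ^ 2) ^ 2\<close> gives the
  polynomial \<open>F\<close>, which has maximum \<open>0\<close> on \<open>M\<close>, so no
  quotient has to be differentiated.\<close>

locale barrier =
  fixes u :: "'a::euclidean_space" and ch sh c D :: real
  assumes u: "norm u = 1" and chsh: "ch\<^sup>2 - sh\<^sup>2 = 1"
begin

abbreviation "w0 \<equiv> boosted_time ch sh u"
abbreviation "w1 \<equiv> boosted_height ch sh u"

definition "F x = (w0 x)\<^sup>2 - c * (w1 x)\<^sup>2 - D * (1 - x \<bullet> x)\<^sup>2"

text \<open>As \<open>F\<close> depends on \<open>x\<close> only through
  \<open>x \<bullet> x\<close> and \<open>x \<bullet> u\<close>, its gradient lies in the span of
  \<open>x\<close> and \<open>u\<close>; \<open>K\<close> and \<open>J\<close> carry the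
  coefficients.\<close>

definition "K x = w0 x * ch + c * w1 x * sh + D * (1 - x \<bullet> x)"

definition "J x = w0 x * sh + c * w1 x * ch"

definition "grad x = (4 * K x) *\<^sub>R x - (4 * J x) *\<^sub>R u"

definition "hess x v = (8 * (ch * (ch * (x \<bullet> v) - sh * (u \<bullet> v)) + c * sh * (ch * (u \<bullet> v) - sh * (x \<bullet> v))
    - D * (x \<bullet> v))) *\<^sub>R x + (4 * K x) *\<^sub>R v
  - (8 * (sh * (ch * (x \<bullet> v) - sh * (u \<bullet> v)) + c * ch * (ch * (u \<bullet> v) - sh * (x \<bullet> v)))) *\<^sub>R u"

lemma w0_has_derivative:
  "(w0 has_derivative (\<lambda>v. 2 * (ch * (x \<bullet> v) - sh * (u \<bullet> v)))) (at x)"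
  unfolding boosted_time_def
  by (auto intro!: derivative_eq_intros ext simp: inner_commute algebra_simps)

lemma w1_has_derivative:
  "(w1 has_derivative (\<lambda>v. 2 * (ch * (u \<bullet> v) - sh * (x \<bullet> v)))) (at x)"
  unfolding boosted_height_def
  by (auto intro!: derivative_eq_intros ext simp: inner_commute algebra_simps)

lemma F_has_derivative: "(F has_derivative (\<lambda>v. grad x \<bullet> v)) (at x)"
  unfolding F_def
  by (auto intro!: derivative_eq_intros w0_has_derivative w1_has_derivative ext
      simp: grad_def K_def J_def inner_diff_left inner_commute power2_eq_square algebra_simps)

lemma K_has_derivative: "(K has_derivative (\<lambda>v. 2 * (ch * (ch * (x \<bullet> v) - sh * (u \<bullet> v))
    + c * sh * (ch * (u \<bullet> v) - sh * (x \<bullet> v)) - D * (x \<bullet> v)))) (at x)"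
  unfolding K_def
  by (auto intro!: derivative_eq_intros w0_has_derivative w1_has_derivative ext
      simp: inner_commute algebra_simps)

lemma J_has_derivative: "(J has_derivative (\<lambda>v. 2 * (sh * (ch * (x \<bullet> v) - sh * (u \<bullet> v))
    + c * ch * (ch * (u \<bullet> v) - sh * (x \<bullet> v))))) (at x)"
  unfolding J_def
  by (auto intro!: derivative_eq_intros w0_has_derivative w1_has_derivative ext
      simp: inner_commute algebra_simps)

lemma grad_has_derivative: "(grad has_derivative hess x) (at x)"
proof -
  have "((\<lambda>x. (4 * K x) *\<^sub>R x - (4 * J x) *\<^sub>R u) has_derivative hess x) (at x)"
    by (rule derivative_eq_intros K_has_derivative J_has_derivative refl)+
      (auto simp: hess_def algebra_simps)
  then show ?thesis by (simp add: grad_def[abs_def])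
qed

text \<open>With \<open>N\<close> the quadratic form below, \<open>F x = 0\<close> says that \<open>(w0, w1, 1 - norm x ^ 2)\<close> is a null vector
  and \<open>grad x \<bullet> b = 0\<close> that the vector entering \<open>N\<close> is orthogonal to it; hence \<open>N\<close> has rank one.\<close>

lemma barrier_trace_pos:
  assumes x: "norm x < 1" "F x = 0" and c: "1 \<le> c" "c < 2" and D: "1 \<le> D"
    and B: "finite B" "card B \<ge> 2" "\<And>b c. b \<in> B \<Longrightarrow> c \<in> B \<Longrightarrow> b \<bullet> c = (if b = c then 1 else 0)"
    and grad: "\<And>b. b \<in> B \<Longrightarrow> grad x \<bullet> b = 0"
  shows "(\<Sum>b\<in>B. hess x b \<bullet> b + 2 / (1 - x \<bullet> x) * (grad x \<bullet> x)) > 0"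
proof -
  define s where "s = 1 - x \<bullet> x"
  have "x \<bullet> x < 1" using x by (simp add: inner_self_lt_1)
  then have s: "s > 0" by (simp add: s_def)
  define N where "N = (\<lambda>b. D * (x \<bullet> b)\<^sup>2 + c * (ch * (u \<bullet> b) - sh * (x \<bullet> b))\<^sup>2 - (ch * (x \<bullet> b) - sh * (u \<bullet> b))\<^sup>2)"
  define l where "l = (w1 x - s * sh) *\<^sub>R x + (s * ch) *\<^sub>R u"
  have null: "(w0 x)\<^sup>2 = c * (w1 x)\<^sup>2 + D * s\<^sup>2" using x(2) by (simp add: F_def s_def)
  have uu: "u \<bullet> u = 1" using u by (simp add: norm_eq_1)
  \<comment> \<open>This combination arises from the conformal correction in \<open>conf\<close>;
    \<open>F x = 0\<close> turns it into a multiple of \<open>D * s\<close>.\<close>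
  have "K x * (1 + x \<bullet> x) - 2 * (J x * (x \<bullet> u)) = (w0 x)\<^sup>2 - c * (w1 x)\<^sup>2 + D * s * (1 + x \<bullet> x)"
    unfolding K_def J_def s_def[symmetric]
    by (simp add: boosted_time_def boosted_height_def power2_eq_square algebra_simps)
  also have "\<dots> = 2 * D * s" unfolding null by (simp add: s_def power2_eq_square algebra_simps)
  finally have KJ: "K x * (1 + x \<bullet> x) - 2 * (J x * (x \<bullet> u)) = 2 * D * s" .
  have "s * (4 * K x + 2 / s * (grad x \<bullet> x)) = s * (8 * D)"
  proof -
    have g: "grad x \<bullet> x = 4 * (K x * (x \<bullet> x)) - 4 * (J x * (x \<bullet> u))"
      by (simp add: grad_def inner_diff_left inner_commute[of u x])
    have "s * (4 * K x + 2 / s * (grad x \<bullet> x)) = 4 * (K x * (s + 2 * (x \<bullet> x)) - 2 * (J x * (x \<bullet> u)))"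
      unfolding g using s by (simp add: field_simps)
    also have "s + 2 * (x \<bullet> x) = 1 + x \<bullet> x" by (simp add: s_def)
    finally show ?thesis unfolding KJ by simp
  qed
  then have conf: "4 * K x + 2 / s * (grad x \<bullet> x) = 8 * D" using s by simp
  have trace_summand: "hess x b \<bullet> b + 2 / s * (grad x \<bullet> x) = 8 * (D - N b)" if "b \<in> B" for b
  proof -
    have "hess x b \<bullet> b = 4 * K x - 8 * N b"
      using B(3)[OF that that]
      by (simp add: hess_def N_def inner_diff_left inner_add_left power2_eq_square algebra_simps)
    with conf show ?thesis by simp
  qed
  have N: "(w0 x)\<^sup>2 * N b = c * D * (l \<bullet> b)\<^sup>2" if "b \<in> B" for b
  proof -
    define p q r where "p = x \<bullet> b" and "q = ch * (u \<bullet> b) - sh * (x \<bullet> b)" and "r = ch * (x \<bullet> b) - sh * (u \<bullet> b)"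
    have "K x * (x \<bullet> b) - J x * (u \<bullet> b) = 0"
      using grad[OF that] by (simp add: grad_def inner_diff_left)
    then have "w0 x * r = c * w1 x * q - D * s * p"
      by (simp add: K_def J_def s_def p_def q_def r_def algebra_simps)
    then have "(w0 x)\<^sup>2 * r\<^sup>2 = (c * w1 x * q - D * s * p)\<^sup>2" by (metis power_mult_distrib)
    then have "(w0 x)\<^sup>2 * N b = (c * (w1 x)\<^sup>2 + D * s\<^sup>2) * (D * p\<^sup>2 + c * q\<^sup>2) - (c * w1 x * q - D * s * p)\<^sup>2"
      unfolding null[symmetric] by (simp add: N_def p_def q_def r_def algebra_simps)
    \<comment> \<open>Lagrange's identity for the plane vectors with entries \<open>w1 x\<close>,
      \<open>s\<close> and \<open>p\<close>, \<open>q\<close>, weighted by the square roots of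
      \<open>c\<close> and \<open>D\<close>.\<close>
    also have "\<dots> = c * D * (w1 x * p + s * q)\<^sup>2"
      by (simp add: power2_eq_square algebra_simps)
    also have "w1 x * p + s * q = l \<bullet> b"
      by (simp add: l_def p_def q_def inner_add_left algebra_simps)
    finally show ?thesis .
  qed
  have ll: "l \<bullet> l = (w1 x)\<^sup>2 + s\<^sup>2"
  proof -
    have "ch * ch = 1 + sh * sh" using chsh by (simp add: power2_eq_square)
    \<comment> \<open>Rewriting with this rule eliminates all powers of \<open>ch\<close> above the
      first, so that both sides reach one normal form.\<close>
    then have red: "ch * (ch * y) = y + sh * (sh * y)" for y
      by (simp add: distrib_right flip: mult.assoc)
    have "l \<bullet> l = (w1 x - s * sh)\<^sup>2 * (x \<bullet> x) + 2 * (w1 x - s * sh) * (s * ch) * (x \<bullet> u) + s\<^sup>2 * ch\<^sup>2"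
      by (simp add: l_def inner_add_left inner_add_right uu inner_commute power2_eq_square algebra_simps)
    also have "\<dots> = (w1 x)\<^sup>2 + s\<^sup>2"
      unfolding boosted_height_def s_def
      by (simp add: power2_eq_square algebra_simps red \<open>ch * ch = 1 + sh * sh\<close>)
    finally show ?thesis .
  qed
  \<comment> \<open>Here \<open>1 \<le> c\<close> and \<open>1 \<le> D\<close> enter:
    \<open>l / w0 x\<close> has length at most \<open>1\<close>, so Bessel bounds the trace of the
    rank-one form \<open>N\<close> by \<open>c * D\<close>.\<close>
  have "(w1 x)\<^sup>2 + s\<^sup>2 \<le> (w0 x)\<^sup>2"
    unfolding null using c D mult_right_mono[of 1 c "(w1 x)\<^sup>2"] mult_right_mono[of 1 D "s\<^sup>2"] by simp
  then have bound: "(\<Sum>b\<in>B. (l \<bullet> b)\<^sup>2) \<le> (w0 x)\<^sup>2"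
    using Bessel_inequality[OF B(1,3), of l] ll by simp
  have "s\<^sup>2 > 0" using s by simp
  then have w0: "(w0 x)\<^sup>2 > 0" using \<open>(w1 x)\<^sup>2 + s\<^sup>2 \<le> (w0 x)\<^sup>2\<close> by (smt (verit) zero_le_power2)
  have "(w0 x)\<^sup>2 * (\<Sum>b\<in>B. N b) = c * D * (\<Sum>b\<in>B. (l \<bullet> b)\<^sup>2)"
    by (simp add: sum_distrib_left N)
  also have "\<dots> \<le> c * D * (w0 x)\<^sup>2" using bound c D by (intro mult_left_mono) auto
  finally have "(\<Sum>b\<in>B. N b) \<le> c * D" using w0 by (simp add: mult.commute)
  also have "\<dots> < card B * D" using c D B(2) by (intro mult_strict_right_mono) auto
  finally have "(\<Sum>b\<in>B. 8 * (D - N b)) > 0"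
    by (simp add: sum_subtractf flip: sum_distrib_left)
  moreover have "(\<Sum>b\<in>B. hess x b \<bullet> b + 2 / (1 - x \<bullet> x) * (grad x \<bullet> x)) = (\<Sum>b\<in>B. 8 * (D - N b))"
    unfolding s_def[symmetric] using trace_summand by (rule sum.cong[OF refl])
  ultimately show ?thesis by simp
qed

end

lemma minimal_submanifold_avoids_waist:
  fixes u :: "'a::euclidean_space"
  assumes M: "hyperbolic_submanifold k M" "minimal hyperbolic_metric M" and "2 \<le> k"
    and u: "norm u = 1" and chsh: "ch\<^sup>2 - sh\<^sup>2 = 1" and c: "1 \<le> c" "c < 2"
    and ideal: "\<And>x. x \<in> ideal_boundary M \<Longrightarrow> (boosted_time ch sh u x)\<^sup>2 < c * (boosted_height ch sh u x)\<^sup>2"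
    and "x0 \<in> M"
  shows "boosted_height ch sh u x0 \<noteq> 0"
proof
  assume x0: "boosted_height ch sh u x0 = 0"
  \<comment> \<open>The numerator of \<open>X0 ^ 2 - c * Z ^ 2 - 1\<close>. It is negative at the
    ideal points of \<open>M\<close>, so the set where it is nonnegative stays inside the ball and
    is compact.\<close>
  define Q where "Q = (\<lambda>x. (boosted_time ch sh u x)\<^sup>2 - c * (boosted_height ch sh u x)\<^sup>2 - (1 - x \<bullet> x)\<^sup>2)"
  define A where "A = closure M \<inter> {x. 0 \<le> Q x}"
  obtain C where C: "closed C" "M = ball 0 1 \<inter> C"
    using M(1) by (auto simp: hyperbolic_submanifold_def closedin_closed)
  have MB: "M \<subseteq> ball 0 1" using C by auto
  have clM: "closure M \<subseteq> cball 0 1" "closure M \<subseteq> C"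
    using closure_minimal[OF subset_trans[OF MB ball_subset_cball] closed_cball] closure_minimal[of M C] C by auto
  have AM: "A \<subseteq> M"
  proof
    fix x assume x: "x \<in> A"
    have "norm x \<noteq> 1"
    proof
      assume n: "norm x = 1"
      then have "x \<in> ideal_boundary M" using x by (simp add: A_def ideal_boundary_def)
      moreover have "x \<bullet> x = 1" using n by (simp add: norm_eq_1)
      ultimately show False using ideal[of x] x by (simp add: A_def Q_def)
    qed
    then have "x \<in> ball 0 1" using x clM(1) by (auto simp: A_def)
    then show "x \<in> M" using x clM(2) C(2) by (auto simp: A_def)
  qed
  have contQ: "continuous_on UNIV Q" unfolding Q_def by (intro continuous_intros)
  have "closed {x. 0 \<le> Q x}"
    using closed_Collect_le[OF continuous_on_const contQ] .
  moreover have "compact (closure M)" using bounded_subset[OF bounded_cball MB[THEN subset_trans, OF ball_subset_cball]] by simp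
  ultimately have "compact A" unfolding A_def by (intro compact_Int_closed)
  have A1: "1 - x \<bullet> x > 0" if "x \<in> A" for x using that AM MB inner_self_lt_1[of x] by auto
  have "x0 \<in> A"
  proof -
    \<comment> \<open>At height zero, \<open>Q x0\<close> is four times the difference of these two
      sides.\<close>
    have "(x0 \<bullet> u)\<^sup>2 \<le> x0 \<bullet> x0" using Cauchy_Schwarz_ineq[of x0 u] u by (simp add: norm_eq_1)
    then have "0 \<le> Q x0" using boosted_time_height[OF chsh, of u x0] x0 by (simp add: Q_def)
    then show ?thesis using \<open>x0 \<in> M\<close> closure_subset by (auto simp: A_def)
  qed
  moreover have "continuous_on A (\<lambda>x. Q x / (1 - x \<bullet> x)\<^sup>2)"
    using A1 by (intro continuous_intros continuous_on_subset[OF contQ]) force+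
  ultimately obtain p where p: "p \<in> A" "\<And>x. x \<in> A \<Longrightarrow> Q x / (1 - x \<bullet> x)\<^sup>2 \<le> Q p / (1 - p \<bullet> p)\<^sup>2"
    using continuous_attains_sup[OF \<open>compact A\<close>] by blast
  define E where "E = Q p / (1 - p \<bullet> p)\<^sup>2"
  have E: "E \<ge> 0" using p(1) by (simp add: E_def A_def)
  \<comment> \<open>The \<open>1\<close> restores what was subtracted in \<open>Q\<close>; it also
    gives the bound \<open>1 \<le> D\<close> needed by \<open>barrier_trace_pos\<close>.\<close>
  interpret barrier u ch sh c "1 + E" by unfold_locales (use u chsh in auto)
  have F: "F x = Q x - E * (1 - x \<bullet> x)\<^sup>2" for x unfolding F_def Q_def by (simp add: algebra_simps)
  have Fp: "F p = 0" unfolding F using A1[OF p(1)] by (simp add: E_def)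
  have max: "F x \<le> F p" if "x \<in> M" for x
  proof (cases "0 \<le> Q x")
    case True
    then have "x \<in> A" using that closure_subset by (auto simp: A_def)
    from p(2)[OF this] A1[OF this] show ?thesis
      unfolding Fp by (simp add: F flip: E_def) (simp add: divide_le_eq)
  next
    case False
    moreover have "0 \<le> E * (1 - x \<bullet> x)\<^sup>2" using E by simp
    ultimately show ?thesis unfolding Fp unfolding F by linarith
  qed
  have pM: "p \<in> M" "norm p < 1" using p(1) AM MB by auto
  have sm: "smooth_submanifold k M" "k > 0" using M(1) \<open>2 \<le> k\<close> by (auto simp: hyperbolic_submanifold_def)
  show False
  proof (rule minimal_submanifold_trace_le[OF sm(1) M(2) sm(2) pM F_has_derivative grad_has_derivative max])
    fix B :: "'a set"
    assume B: "finite B" "card B = k" "\<And>b c. b \<in> B \<Longrightarrow> c \<in> B \<Longrightarrow> b \<bullet> c = (if b = c then 1 else 0)"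
      "\<And>b. b \<in> B \<Longrightarrow> grad p \<bullet> b = 0"
      "(\<Sum>b\<in>B. hess p b \<bullet> b + 2 / (1 - p \<bullet> p) * (grad p \<bullet> p)) \<le> 0"
    have "card B \<ge> 2" using B(2) \<open>2 \<le> k\<close> by simp
    from barrier_trace_pos[OF pM(2) Fp c _ B(1) this B(3,4)] B(5) E show False by simp
  qed
qed

lemma isotopic_refl: "isotopic L L"
proof -
  have sm: "smooth_map_on (sphere 0 1) (\<lambda>x. x)"
    by (rule smooth_map_on_bounded_linear[OF bounded_linear_ident])
  have "sphere_isotopy snd"
    unfolding sphere_isotopy_def
    using smooth_map_on_bounded_linear[OF bounded_linear_snd] diffeomorphism_betwI[OF sm sm] by auto
  then show ?thesis unfolding isotopic_def by (intro exI[of _ snd]) auto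
qed

theorem proposition1p8:
  fixes L1 L2 :: "'a::euclidean_space set" and k :: nat
  assumes "2 \<le> k"
    and "L1 \<noteq> {}" and "L1 \<subseteq> sphere 0 1" and "smooth_submanifold (k - 1) L1"
    and "L2 \<noteq> {}" and "L2 \<subseteq> sphere 0 1" and "smooth_submanifold (k - 1) L2"
    and "separated L1 L2"
  shows "\<exists>L'. isotopic (L1 \<union> L2) L' \<and>
           \<not> (\<exists>M. hyperbolic_submanifold k M \<and> connected M \<and>
                  minimal hyperbolic_metric M \<and> ideal_boundary M = L')"
proof (cases "closed (L1 \<union> L2)")
  case False
  moreover have "closed (ideal_boundary M)" for M :: "'a set"
    by (simp add: ideal_boundary_def closed_Int)
  ultimately show ?thesis using isotopic_refl by metis
next
  case True
  obtain B1 B2 where B: "sphere_ball B1" "sphere_ball B2" "B1 \<inter> B2 = {}" "L1 \<subseteq> B1" "L2 \<subseteq> B2"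
    using assms(8) by (auto simp: separated_def)
  obtain O2 where O2: "open O2" "B2 = sphere 0 1 \<inter> O2"
    using B(2) by (auto simp: sphere_ball_def openin_open)
  \<comment> \<open>The open set \<open>O2\<close> splits \<open>L2\<close> off, so
    \<open>L1\<close> inherits closedness from the union.\<close>
  have "L1 = (L1 \<union> L2) \<inter> - O2" using B O2 assms(3,6) by auto
  then have "closed L1" using True O2(1) by (metis closed_Int closed_Compl)
  then have L1: "compact L1" using assms(3) bounded_subset[OF bounded_sphere] compact_eq_bounded_closed by blast
  have B1: "openin (top_of_set (sphere 0 1)) B1" using B(1) by (simp add: sphere_ball_def)
  obtain W :: "'a set" and f where f: "diffeomorphism_betw (W \<inter> ball 0 1) B1 f" and W: "subspace W"
    using B(1) unfolding sphere_ball_def by blast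
  define u where "u = f 0"
  have uB: "u \<in> B1"
    using f W subspace_0[OF W] by (auto simp: u_def diffeomorphism_betw_def bij_betw_def)
  obtain O1 where O1: "open O1" "B1 = sphere 0 1 \<inter> O1" using B1 by (auto simp: openin_open)
  have u: "norm u = 1" and uu: "u \<bullet> u = 1" using uB O1 by (auto simp: norm_eq_1)
  obtain d where d: "d > 0" "ball u d \<subseteq> O1" using O1 uB open_contains_ball by blast
  \<comment> \<open>For unit vectors, \<open>norm (x - u) \<ge> d\<close> means
    \<open>x \<bullet> u \<le> 1 - d ^ 2 / 2\<close>. The maximum with \<open>0\<close> ensures
    \<open>\<mu> \<ge> 4\<close> below.\<close>
  define z where "z = max 0 (1 - d\<^sup>2 / 2)"
  have z: "0 \<le> z" "z < 1" using d(1) by (auto simp: z_def)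
  have L2z: "x \<bullet> u \<le> z" if "x \<in> L2" for x
  proof -
    have "x \<notin> B1" using that B by auto
    then have "d \<le> norm (x - u)" using that assms(6) O1 d(2) by (force simp: dist_norm norm_minus_commute)
    then have "d\<^sup>2 \<le> (norm (x - u))\<^sup>2" using d(1) by (intro power_mono) auto
    also have "\<dots> = x \<bullet> x - 2 * (x \<bullet> u) + u \<bullet> u"
      by (simp add: power2_norm_eq_inner inner_diff_left inner_diff_right inner_commute)
    also have "x \<bullet> x = 1" using that assms(6) by (auto simp: norm_eq_1[symmetric])
    finally show ?thesis by (simp add: z_def uu)
  qed
  \<comment> \<open>\<open>\<mu> = exp \<tau>\<close> for a boost strong enough to push \<open>L2\<close> far below the hyperplane \<open>w1 = 0\<close>.\<close>
  define \<mu> where "\<mu> = 4 / (1 - z)"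
  have \<mu>: "\<mu> \<ge> 4" using z by (simp add: \<mu>_def field_simps)
  define ch sh where "ch = (\<mu> + 1 / \<mu>) / 2" and "sh = (\<mu> - 1 / \<mu>) / 2"
  have chsh: "ch\<^sup>2 - sh\<^sup>2 = 1" using \<mu> by (simp add: ch_def sh_def power2_eq_square field_simps)
  have ch: "ch > 0" using \<mu> by (simp add: ch_def add_pos_pos)
  let ?w0 = "boosted_time ch sh u" and ?w1 = "boosted_height ch sh u"
  have gap: "sh - z * ch \<ge> 3/2"
  proof -
    \<comment> \<open>The first term equals \<open>4\<close> by the choice of \<open>\<mu>\<close>
      and the second is at most \<open>1\<close>, which leaves \<open>3/2\<close>.\<close>
    have "sh - z * ch = (\<mu> * (1 - z) - (1 + z) / \<mu>) / 2" using \<mu> by (simp add: ch_def sh_def field_simps)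
    moreover have "\<mu> * (1 - z) = 4" using z by (simp add: \<mu>_def divide_eq_eq)
    moreover have "(1 + z) / \<mu> \<le> 1" using \<mu> z by (simp add: divide_le_eq)
    ultimately show ?thesis by simp
  qed
  have low: "?w1 x < 0 \<and> (?w0 x)\<^sup>2 < 3/2 * (?w1 x)\<^sup>2" if "x \<in> L2" for x
  proof -
    have xx: "x \<bullet> x = 1" using that assms(6) by (auto simp: norm_eq_1[symmetric])
    have "(x \<bullet> u) * ch \<le> z * ch" using L2z[OF that] ch by simp
    then have w: "?w1 x \<le> - 3" using gap by (simp add: boosted_height_def xx)
    \<comment> \<open>On the sphere the squares of \<open>w0\<close> and \<open>w1\<close> differ by
      at most \<open>4\<close>, which is less than half of \<open>9\<close>; this yields the factor
      \<open>3/2\<close>.\<close>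
    then have "9 \<le> (?w1 x)\<^sup>2" using power_mono[of 3 "- ?w1 x" 2] by simp
    moreover have "(?w0 x)\<^sup>2 - (?w1 x)\<^sup>2 \<le> 4"
      using boosted_time_height[OF chsh, of u x] by (simp add: xx)
    ultimately show ?thesis using w by simp
  qed
  \<comment> \<open>An open condition that holds at \<open>u\<close>, where \<open>w1\<close> is
    positive and \<open>w0\<close> and \<open>w1\<close> have equal squares.\<close>
  define N where "N = {x. ?w1 x > 0} \<inter> {x. (?w0 x)\<^sup>2 < 3/2 * (?w1 x)\<^sup>2}"
  have "open N"
    unfolding N_def by (intro open_Int open_Collect_less continuous_intros)
  moreover have "f 0 \<in> N"
  proof -
    have "?w1 u > 0" using \<mu> by (simp add: boosted_height_def uu ch_def sh_def field_simps)
    moreover have "(?w0 u)\<^sup>2 = (?w1 u)\<^sup>2" using boosted_time_height[OF chsh, of u u] by (simp add: uu)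
    ultimately show ?thesis by (simp add: N_def flip: u_def)
  qed
  ultimately obtain h where h: "sphere_isotopy h" "\<And>x. x \<in> L1 \<Longrightarrow> h (1, x) \<in> N" "\<And>x. x \<notin> B1 \<Longrightarrow> h (1, x) = x"
    using sphere_isotopy_into_neighbourhood[OF f W B1 L1 B(4)] by metis
  define L' where "L' = (\<lambda>x. h (1, x)) ` (L1 \<union> L2)"
  have hL2: "h (1, x) = x" if "x \<in> L2" for x using that h(3) B by auto
  have "isotopic (L1 \<union> L2) L'" unfolding isotopic_def L'_def using h(1) by blast
  moreover have False if M: "hyperbolic_submanifold k M" "connected M" "minimal hyperbolic_metric M" "ideal_boundary M = L'" for M
  proof -
    have "(?w0 x)\<^sup>2 < 3/2 * (?w1 x)\<^sup>2" if "x \<in> ideal_boundary M" for x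
      using that h(2) low unfolding M(4) L'_def by (auto simp: hL2 N_def)
    then have nz: "?w1 x \<noteq> 0" if "x \<in> M" for x
      using minimal_submanifold_avoids_waist[OF M(1,3) assms(1) u chsh, of "3/2"] that by simp
    obtain x1 x2 where "x1 \<in> L1" "x2 \<in> L2" using assms(2,5) by blast
    then have x1: "h (1, x1) \<in> closure M" "?w1 (h (1, x1)) > 0" and x2: "x2 \<in> closure M" "?w1 x2 < 0"
      using M(4) h(2) low hL2 by (force simp: ideal_boundary_def L'_def N_def)+
    have "connected (?w1 ` M)" using M(2) by (intro connected_continuous_image continuous_intros)
    \<comment> \<open>The inequalities are weak so that they pass to the closure of
      \<open>M\<close>, which contains points of both caps.\<close>
    then have sign: "(\<forall>x\<in>M. 0 \<le> ?w1 x) \<or> (\<forall>x\<in>M. ?w1 x \<le> 0)"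
      using nz connectedD_interval[of "?w1 ` M" _ _ 0] by (metis (no_types, lifting) image_iff linear)
    have "closed {x. 0 \<le> ?w1 x}" "closed {x. ?w1 x \<le> 0}" by (intro closed_Collect_le continuous_intros)+
    with sign have "closure M \<subseteq> {x. 0 \<le> ?w1 x} \<or> closure M \<subseteq> {x. ?w1 x \<le> 0}"
      by (metis (no_types, lifting) closure_minimal mem_Collect_eq subsetI)
    then show False using x1 x2 by auto
  qed
  ultimately show ?thesis by blast
qed

end
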